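(* Let $\theta \in (0, \pi/2)$ be fixed. Then, as $d \to \infty$, $$A(d,\theta) \ge (1+o(1)) \, \frac{c_\theta \cdot d}{s_d(\theta)},$$ where $$c_\theta = \log\left(\frac{\sin\theta}{\sin q(\theta)}\right) = \log \frac{\sin^2\theta}{\sqrt{(1-\cos\theta)^2(1+2\cos\theta)}}.$$
   Context: $S_{d-1}$ is the unit sphere in $\mathbb{R}^d$. A spherical code of angle $\theta$ in dimension $d$ is a set of unit vectors $x_1,\dots,x_k \in S_{d-1}$ with $\langle x_i,x_j\rangle \le \cos\theta$ for all $i\neq j$; its size is $k$. $A(d,\theta)$ is the size of the largest spherical code of angle $\theta$ in dimension $d$. $s(\cdot)$ is the normalized surface area on $S_{d-1}$ (so $s(S_{d-1})=1$), $C_\theta(x) = \{y \in S_{d-1} : \langle x,y\rangle \ge \cos\theta\}$ is the spherical cap of angular radius $\theta$ around $x\in S_{d-1}$, and $s_d(\theta) = s(C_\theta(x))$, i.e. $$s_d(\theta) = \frac{1}{\sqrt{\pi}} \frac{\Gamma(d/2)}{\Gamma((d-1)/2)} \int_0^\theta \sin^{d-2} x \, dx.$$ $q(\theta)$ is the angular radius of the smallest spherical cap that contains the intersection of two spherical caps of angular radius $\theta$ whose centers are at angle $\theta$; that is, $$q(\theta) = \arcsin\left(\frac{\sqrt{(\cos\theta-1)^2(1+2\cos\theta)}}{\sin\theta}\right).$$ $\log$ is the natural logarithm; $o(1)$ denotes a quantity tending to $0$ as $d\to\infty$ with $\theta$ fixed. *)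

theory Defs
  imports "HOL-Analysis.Analysis"
begin

text \<open>
  The dimension \<open>d\<close> tends to infinity in the main statement, so it cannot be a type. Points of
  \<open>d\<close>-dimensional Euclidean space are the extensional functions on \<open>{..<d}\<close>, i.e. the elements of
  the space of the product measure \<open>PiM {..<d} (\<lambda>_. lborel)\<close>, which is Lebesgue measure in
  dimension \<open>d\<close>.
\<close>

definition euclid :: "nat \<Rightarrow> (nat \<Rightarrow> real) set" where
  "euclid d = ({..<d} \<rightarrow>\<^sub>E UNIV)"

definition ip :: "nat \<Rightarrow> (nat \<Rightarrow> real) \<Rightarrow> (nat \<Rightarrow> real) \<Rightarrow> real" where
  "ip d x y = (\<Sum>i<d. x i * y i)"

definition unit_sphere :: "nat \<Rightarrow> (nat \<Rightarrow> real) set" where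
  "unit_sphere d = {x \<in> euclid d. sqrt (ip d x x) = 1}"

definition spherical_code :: "nat \<Rightarrow> real \<Rightarrow> (nat \<Rightarrow> real) set \<Rightarrow> bool" where
  "spherical_code d \<theta> X \<longleftrightarrow>
     finite X \<and> X \<subseteq> unit_sphere d \<and> (\<forall>x\<in>X. \<forall>y\<in>X. x \<noteq> y \<longrightarrow> ip d x y \<le> cos \<theta>)"

text \<open>
  The maximum is over a finite nonempty set when \<open>0 < \<theta> \<le> pi\<close>; see
  \<open>finite_code_sizes\<close> below.
\<close>

definition max_code_size :: "nat \<Rightarrow> real \<Rightarrow> nat" where
  "max_code_size d \<theta> = Max {card X |X. spherical_code d \<theta> X}"

text \<open>
  Normalized surface area on the sphere: the surface area of \<open>A\<close> is proportional to the Lebesgue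
  measure of the cone \<open>{r x. 0 \<le> r \<le> 1, x \<in> A}\<close>, and the cone over the whole sphere is the unit
  ball.
\<close>

definition cone_over :: "nat \<Rightarrow> (nat \<Rightarrow> real) set \<Rightarrow> (nat \<Rightarrow> real) set" where
  "cone_over d A = {(\<lambda>i\<in>{..<d}. r * x i) |r x. r \<in> {0..1} \<and> x \<in> A}"

definition sphere_area :: "nat \<Rightarrow> (nat \<Rightarrow> real) set \<Rightarrow> real" where
  "sphere_area d A =
     measure (PiM {..<d} (\<lambda>_. lborel)) (cone_over d A) /
     measure (PiM {..<d} (\<lambda>_. lborel)) (cone_over d (unit_sphere d))"

definition spherical_cap :: "nat \<Rightarrow> real \<Rightarrow> (nat \<Rightarrow> real) \<Rightarrow> (nat \<Rightarrow> real) set" where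
  "spherical_cap d \<theta> x = {y \<in> unit_sphere d. cos \<theta> \<le> ip d x y}"

text \<open>
  By rotation invariance the area of a cap does not depend on its centre; the first standard basis
  vector is used. The closed form in terms of the Gamma function is \<open>cap_area_eq\<close> below.
\<close>

definition pole :: "nat \<Rightarrow> (nat \<Rightarrow> real)" where
  "pole d = (\<lambda>i\<in>{..<d}. if i = 0 then 1 else 0)"

definition cap_area :: "nat \<Rightarrow> real \<Rightarrow> real" where
  "cap_area d \<theta> = sphere_area d (spherical_cap d \<theta> (pole d))"

text \<open>
  Angular radius of the smallest cap containing the intersection of two caps of angular radius \<open>\<theta>\<close>
  whose centres are at angle \<open>\<theta>\<close>, given by its closed form.
\<close>

definition q_angle :: "real \<Rightarrow> real" where
  "q_angle \<theta> = arcsin (sqrt ((cos \<theta> - 1)\<^sup>2 * (1 + 2 * cos \<theta>)) / sin \<theta>)"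

definition c_const :: "real \<Rightarrow> real" where
  "c_const \<theta> = ln (sin \<theta> / sin (q_angle \<theta>))"


lemma finite_code_sizes:
  assumes "0 < \<theta>" "\<theta> \<le> pi"
  shows "finite {card X |X. spherical_code d \<theta> X}"
    and "{card X |X. spherical_code d \<theta> X} \<noteq> {}"
proof -
  have c1: "cos \<theta> < 1"
    using cos_monotone_0_pi[of 0 \<theta>] assms by simp
  obtain N :: nat where N: "real d / (2 - 2 * cos \<theta>) < real N"
    using reals_Archimedean2 by blast
  have N0: "N > 0"
  proof (rule ccontr)
    assume "\<not> N > 0"
    then have "N = 0" by simp
    with N have "real d / (2 - 2 * cos \<theta>) < 0" by simp
    moreover have "real d / (2 - 2 * cos \<theta>) \<ge> 0" using c1 by simp
    ultimately show False by simp
  qed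
  have dN: "real d < (2 - 2 * cos \<theta>) * real N"
    using N c1 by (simp add: field_simps)
  define g where "g x = (\<lambda>i\<in>{..<d}. \<lfloor>real N * x i\<rfloor>)" for x :: "nat \<Rightarrow> real"
  define B where "B = ({..<d} \<rightarrow>\<^sub>E {- int N..int N})"
  have finB: "finite B" unfolding B_def by (intro finite_PiE) auto
  have coord: "\<bar>x i\<bar> \<le> 1" if "x \<in> unit_sphere d" "i < d" for x i
  proof -
    have "x i * x i \<le> ip d x x"
      unfolding ip_def using that(2) by (intro member_le_sum) auto
    also have "\<dots> = 1" using that(1) by (simp add: unit_sphere_def)
    finally have "(x i)\<^sup>2 \<le> 1" by (simp add: power2_eq_square)
    then show ?thesis by (simp add: abs_square_le_1)
  qed
  have le: "card X \<le> card B" if X: "spherical_code d \<theta> X" for X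
  proof (rule card_inj_on_le[of g])
    show "inj_on g X"
    proof (rule inj_onI, rule ccontr)
      fix x y assume xy: "x \<in> X" "y \<in> X" "g x = g y" "x \<noteq> y"
      have sx: "ip d x x = 1" "ip d y y = 1"
        using X xy by (auto simp: spherical_code_def unit_sphere_def)
      have ixy: "ip d x y \<le> cos \<theta>" using X xy by (auto simp: spherical_code_def)
      have "(\<Sum>i<d. (x i - y i)\<^sup>2) = ip d x x + ip d y y - 2 * ip d x y"
        unfolding ip_def
        by (simp add: power2_eq_square algebra_simps sum.distrib sum_subtractf sum_distrib_left)
      then have lo: "2 - 2 * cos \<theta> \<le> (\<Sum>i<d. (x i - y i)\<^sup>2)" using sx ixy by simp
      have "(x i - y i)\<^sup>2 \<le> 1 / (real N)\<^sup>2" if "i < d" for i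
      proof -
        have "\<lfloor>real N * x i\<rfloor> = \<lfloor>real N * y i\<rfloor>"
          using fun_cong[OF xy(3), of i] that by (simp add: g_def)
        then have "\<bar>real N * x i - real N * y i\<bar> \<le> 1" by linarith
        then have "(real N * x i - real N * y i)\<^sup>2 \<le> 1" by (simp add: abs_square_le_1)
        then have "(real N)\<^sup>2 * (x i - y i)\<^sup>2 \<le> 1"
          by (simp add: power_mult_distrib[symmetric] right_diff_distrib)
        then show ?thesis using N0 by (simp add: field_simps)
      qed
      then have "(\<Sum>i<d. (x i - y i)\<^sup>2) \<le> real d * (1 / (real N)\<^sup>2)"
        using sum_bounded_above[of "{..<d}" "\<lambda>i. (x i - y i)\<^sup>2" "1 / (real N)\<^sup>2"] by simp
      then have "2 - 2 * cos \<theta> \<le> real d / (real N)\<^sup>2" using lo by simp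
      then have "(2 - 2 * cos \<theta>) * (real N)\<^sup>2 \<le> real d"
        using N0 by (subst (asm) pos_le_divide_eq) auto
      moreover have "(2 - 2 * cos \<theta>) * real N * 1 \<le> (2 - 2 * cos \<theta>) * real N * real N"
        using c1 N0 by (intro mult_left_mono) auto
      ultimately show False using dN by (simp add: power2_eq_square)
    qed
    show "g ` X \<subseteq> B"
    proof
      fix z assume "z \<in> g ` X"
      then obtain x where x: "x \<in> X" "z = g x" by blast
      have xs: "x \<in> unit_sphere d" using X x by (auto simp: spherical_code_def)
      have "\<lfloor>real N * x i\<rfloor> \<in> {- int N..int N}" if "i < d" for i
      proof -
        have "\<bar>real N * x i\<bar> \<le> real N"
          using coord[OF xs that] by (simp add: abs_mult mult_left_le)
        then have "- real N \<le> real N * x i" "real N * x i \<le> real N" by linarith+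
        then show ?thesis by (simp add: le_floor_iff floor_le_iff)
      qed
      then show "z \<in> B" unfolding x(2) g_def B_def by auto
    qed
    show "finite B" by (rule finB)
  qed
  show "finite {card X |X. spherical_code d \<theta> X}"
    by (rule finite_subset[of _ "{..card B}"]) (use le in auto)
  have "spherical_code d \<theta> {}" by (simp add: spherical_code_def)
  then show "{card X |X. spherical_code d \<theta> X} \<noteq> {}" by blast
qed

lemma integral_sin_power_reduction:
  fixes n :: nat
  assumes "n \<ge> 1" "0 \<le> \<theta>"
  shows "integral {0..\<theta>} (\<lambda>x::real. sin x ^ (n + 1)) + cos \<theta> * sin \<theta> ^ n / (n + 1) =
         n / (n + 1) * integral {0..\<theta>} (\<lambda>x. sin x ^ (n - 1))"
proof -
  have "((\<lambda>x. real (n + 1) * sin x ^ (n + 1) - real n * sin x ^ (n - 1)) has_integral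
          (- cos \<theta> * sin \<theta> ^ n) - (- cos 0 * sin 0 ^ n)) {0..\<theta>}"
  proof (rule fundamental_theorem_of_calculus[OF assms(2)])
    fix x :: real
    obtain m where m: "n = Suc m" using assms(1) by (cases n) auto
    have "((\<lambda>x. - cos x * sin x ^ n) has_real_derivative
            (sin x * sin x ^ n - cos x * (real n * sin x ^ (n - 1) * cos x))) (at x within {0..\<theta>})"
      by (auto intro!: derivative_eq_intros simp: algebra_simps)
    also have "sin x * sin x ^ n - cos x * (real n * sin x ^ (n - 1) * cos x) =
        sin x ^ (n + 1) - real n * sin x ^ (n - 1) * (cos x)\<^sup>2"
      by (simp add: power2_eq_square)
    also have "\<dots> = real (n + 1) * sin x ^ (n + 1) - real n * sin x ^ (n - 1)"
      unfolding cos_squared_eq m by (simp add: algebra_simps power2_eq_square)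
    finally show "((\<lambda>x. - cos x * sin x ^ n) has_vector_derivative
      real (n + 1) * sin x ^ (n + 1) - real n * sin x ^ (n - 1)) (at x within {0..\<theta>})"
      by (simp add: has_real_derivative_iff_has_vector_derivative)
  qed
  moreover have "((\<lambda>x. real (n + 1) * sin x ^ (n + 1) - real n * sin x ^ (n - 1)) has_integral
      real (n + 1) * integral {0..\<theta>} (\<lambda>x. sin x ^ (n + 1)) -
      real n * integral {0..\<theta>} (\<lambda>x. sin x ^ (n - 1))) {0..\<theta>}"
    by (intro has_integral_diff has_integral_mult_right integrable_integral
        integrable_continuous_real continuous_intros)
  ultimately have "(- cos \<theta> * sin \<theta> ^ n) - (- cos 0 * sin 0 ^ n) =
      real (n + 1) * integral {0..\<theta>} (\<lambda>x. sin x ^ (n + 1)) -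
      real n * integral {0..\<theta>} (\<lambda>x. sin x ^ (n - 1))"
    by (rule has_integral_unique)
  moreover have "cos 0 * sin 0 ^ n = (0 :: real)" using assms(1) by simp
  ultimately have "real (n + 1) * integral {0..\<theta>} (\<lambda>x. sin x ^ (n + 1)) -
      real n * integral {0..\<theta>} (\<lambda>x. sin x ^ (n - 1)) = - cos \<theta> * sin \<theta> ^ n"
    by linarith
  then show ?thesis by (simp add: field_simps)
qed

lemma has_integral_cap_profile:
  fixes n :: nat
  assumes "n \<ge> 1" "0 < \<theta>" "\<theta> < pi / 2"
  shows "((\<lambda>y. min (sqrt (1 - y\<^sup>2)) (y * tan \<theta>) ^ n) has_integral
           n / (n + 1) * integral {0..\<theta>} (\<lambda>x. sin x ^ (n - 1))) {0..1}"
proof -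
  define c where "c = cos \<theta>"
  have c: "0 < c" "c < 1"
    using assms cos_gt_zero[of \<theta>] cos_monotone_0_pi[of 0 \<theta>] by (auto simp: c_def)
  have s: "0 < sin \<theta>" using assms by (intro sin_gt_zero) auto
  have t: "0 < tan \<theta>" using assms by (intro tan_gt_zero) auto
  have ac: "arccos c = \<theta>" unfolding c_def using assms by (intro arccos_cos) auto
  have key: "y * tan \<theta> \<le> sqrt (1 - y\<^sup>2) \<longleftrightarrow> y \<le> c" if "0 \<le> y" "y \<le> 1" for y
  proof -
    have "y * tan \<theta> \<le> sqrt (1 - y\<^sup>2) \<longleftrightarrow> (y * tan \<theta>)\<^sup>2 \<le> 1 - y\<^sup>2"
      using that t by (smt (verit) real_le_rsqrt real_sqrt_le_iff real_sqrt_unique mult_nonneg_nonneg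
          real_sqrt_le_mono)
    also have "\<dots> \<longleftrightarrow> y\<^sup>2 * (1 + (tan \<theta>)\<^sup>2) \<le> 1" by (simp add: algebra_simps power_mult_distrib)
    also have "1 + (tan \<theta>)\<^sup>2 = 1 / c\<^sup>2"
      using tan_sec[of \<theta>] c by (simp add: c_def inverse_eq_divide power_divide)
    also have "y\<^sup>2 * (1 / c\<^sup>2) \<le> 1 \<longleftrightarrow> y\<^sup>2 \<le> c\<^sup>2" using c by (simp add: field_simps)
    also have "\<dots> \<longleftrightarrow> y \<le> c" using that c by (simp add: power2_le_iff_abs_le)
    finally show ?thesis .
  qed
  define J where "J u = integral {0..u} (\<lambda>x::real. sin x ^ (n + 1))" for u
  have dJ: "(J has_real_derivative sin u ^ (n + 1)) (at u within {0..pi})" if "u \<in> {0..pi}" for u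
    unfolding J_def by (rule integral_has_real_derivative[OF _ that]) (intro continuous_intros)
  have contJ: "continuous_on {0..pi} J"
    using dJ unfolding continuous_on_eq_continuous_within by (blast intro: DERIV_continuous)
  have "((\<lambda>y. (y * tan \<theta>) ^ n) has_integral
          (tan \<theta> ^ n * c ^ (n + 1) / (n + 1) - tan \<theta> ^ n * 0 ^ (n + 1) / (n + 1))) {0..c}"
  proof (rule fundamental_theorem_of_calculus)
    fix y :: real
    have "((\<lambda>y. tan \<theta> ^ n * y ^ (n + 1) / (n + 1)) has_real_derivative
            tan \<theta> ^ n * (real (n + 1) * y ^ (n + 1 - 1)) / (n + 1)) (at y within {0..c})"
      using DERIV_cdivide[OF DERIV_cmult[OF DERIV_pow[of "n + 1" y "{0..c}"]],
          of "tan \<theta> ^ n" "real (n + 1)"] by simp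
    also have "tan \<theta> ^ n * (real (n + 1) * y ^ (n + 1 - 1)) / (n + 1) = (y * tan \<theta>) ^ n"
      by (simp add: power_mult_distrib del: of_nat_add of_nat_Suc)
    finally show "((\<lambda>y. tan \<theta> ^ n * y ^ (n + 1) / (n + 1)) has_vector_derivative (y * tan \<theta>) ^ n)
            (at y within {0..c})"
      by (simp add: has_real_derivative_iff_has_vector_derivative)
  qed (use c in auto)
  also have "tan \<theta> ^ n * c ^ (n + 1) / (n + 1) - tan \<theta> ^ n * 0 ^ (n + 1) / (n + 1) =
      cos \<theta> * sin \<theta> ^ n / (n + 1)"
    using c by (simp add: tan_def c_def power_divide)
  finally have I1: "((\<lambda>y. min (sqrt (1 - y\<^sup>2)) (y * tan \<theta>) ^ n) has_integral
      cos \<theta> * sin \<theta> ^ n / (n + 1)) {0..c}"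
  proof (rule has_integral_eq[rotated])
    fix y assume "y \<in> {0..c}"
    then show "(y * tan \<theta>) ^ n = min (sqrt (1 - y\<^sup>2)) (y * tan \<theta>) ^ n"
      using key[of y] c by (simp add: min_absorb2)
  qed
  have "((\<lambda>y. sqrt (1 - y\<^sup>2) ^ n) has_integral (- J (arccos 1) - - J (arccos c))) {c..1}"
  proof (rule fundamental_theorem_of_calculus_interior)
    show "continuous_on {c..1} (\<lambda>y. - J (arccos y))"
      by (intro continuous_on_minus continuous_on_compose2[OF contJ] continuous_on_arccos
          continuous_on_id) (use c in \<open>auto simp: arccos_bounded\<close>)
    fix y assume y: "y \<in> {c<..<1}"
    have y1: "-1 < y" "y < 1" using y c by auto
    have a: "arccos y \<in> {0<..<pi}" using arccos_lt_bounded[OF y1] by auto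
    have "at (arccos y) within {0..pi} = at (arccos y)"
      using a by (intro at_within_Icc_at) auto
    then have "(J has_real_derivative sin (arccos y) ^ (n + 1)) (at (arccos y))"
      using dJ[of "arccos y"] a by auto
    from DERIV_chain2[OF this DERIV_arccos[OF y1]]
    have "((\<lambda>y. - J (arccos y)) has_real_derivative
        - (sin (arccos y) ^ (n + 1) * inverse (- sqrt (1 - y\<^sup>2)))) (at y)"
      by (rule DERIV_minus)
    also have "sin (arccos y) = sqrt (1 - y\<^sup>2)" using y1 by (intro sin_arccos) auto
    also have "- (sqrt (1 - y\<^sup>2) ^ (n + 1) * inverse (- sqrt (1 - y\<^sup>2))) = sqrt (1 - y\<^sup>2) ^ n"
    proof -
      have "sqrt (1 - y\<^sup>2) \<noteq> 0" using y1 by (simp add: abs_square_eq_1)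
      then show ?thesis by (simp add: field_simps)
    qed
    finally show "((\<lambda>y. - J (arccos y)) has_vector_derivative sqrt (1 - y\<^sup>2) ^ n) (at y)"
      by (simp add: has_real_derivative_iff_has_vector_derivative)
  qed (use c in auto)
  also have "- J (arccos 1) - - J (arccos c) = J \<theta>" by (simp add: ac J_def)
  finally have I2: "((\<lambda>y. min (sqrt (1 - y\<^sup>2)) (y * tan \<theta>) ^ n) has_integral J \<theta>) {c..1}"
  proof (rule has_integral_eq[rotated])
    fix y assume y: "y \<in> {c..1}"
    have "sqrt (1 - y\<^sup>2) = y * tan \<theta>" if "y = c"
      using key[of y] that c assms sin_cos_sqrt[of \<theta>] s by (simp add: tan_def c_def)
    then have "sqrt (1 - y\<^sup>2) \<le> y * tan \<theta>" using key[of y] y c by fastforce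
    then show "sqrt (1 - y\<^sup>2) ^ n = min (sqrt (1 - y\<^sup>2)) (y * tan \<theta>) ^ n"
      by (simp add: min_absorb1)
  qed
  have "((\<lambda>y. min (sqrt (1 - y\<^sup>2)) (y * tan \<theta>) ^ n) has_integral
      cos \<theta> * sin \<theta> ^ n / (n + 1) + J \<theta>) {0..1}"
    by (rule has_integral_combine[OF _ _ I1 I2]) (use c in auto)
  also have "cos \<theta> * sin \<theta> ^ n / (n + 1) + J \<theta> =
      n / (n + 1) * integral {0..\<theta>} (\<lambda>x. sin x ^ (n - 1))"
    using integral_sin_power_reduction[OF assms(1), of \<theta>] assms(2) by (simp add: J_def)
  finally show ?thesis .
qed

lemma cone_over_subset_sphere:
  assumes "A \<subseteq> unit_sphere d" "A \<noteq> {}"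
  shows "cone_over d A = {f \<in> euclid d. sqrt (ip d f f) \<le> 1 \<and>
           (sqrt (ip d f f) \<noteq> 0 \<longrightarrow> (\<lambda>i\<in>{..<d}. f i / sqrt (ip d f f)) \<in> A)}"
proof (intro set_eqI iffI)
  fix f assume "f \<in> cone_over d A"
  then obtain r x where rx: "f = (\<lambda>i\<in>{..<d}. r * x i)" "0 \<le> r" "r \<le> 1" "x \<in> A"
    by (auto simp: cone_over_def)
  have x: "ip d x x = 1" "x \<in> {..<d} \<rightarrow>\<^sub>E UNIV"
    using rx assms by (auto simp: unit_sphere_def euclid_def)
  have "ip d f f = r\<^sup>2 * ip d x x"
    by (simp add: ip_def rx(1) sum_distrib_left power2_eq_square algebra_simps)
  then have n: "sqrt (ip d f f) = r" using rx x by simp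
  have "(\<lambda>i\<in>{..<d}. f i / r) = x" if "r \<noteq> 0"
    using that x(2) by (auto simp: rx(1) fun_eq_iff restrict_def PiE_def extensional_def)
  then show "f \<in> {f \<in> euclid d. sqrt (ip d f f) \<le> 1 \<and>
           (sqrt (ip d f f) \<noteq> 0 \<longrightarrow> (\<lambda>i\<in>{..<d}. f i / sqrt (ip d f f)) \<in> A)}"
    unfolding mem_Collect_eq n using rx by (simp add: euclid_def)
next
  fix f assume "f \<in> {f \<in> euclid d. sqrt (ip d f f) \<le> 1 \<and>
           (sqrt (ip d f f) \<noteq> 0 \<longrightarrow> (\<lambda>i\<in>{..<d}. f i / sqrt (ip d f f)) \<in> A)}"
  then have f: "f \<in> {..<d} \<rightarrow>\<^sub>E UNIV" "sqrt (ip d f f) \<le> 1"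
    "sqrt (ip d f f) \<noteq> 0 \<Longrightarrow> (\<lambda>i\<in>{..<d}. f i / sqrt (ip d f f)) \<in> A"
    by (auto simp: euclid_def)
  have nn: "ip d f f \<ge> 0" by (auto simp: ip_def intro!: sum_nonneg)
  show "f \<in> cone_over d A"
  proof (cases "sqrt (ip d f f) = 0")
    case True
    then have "f i = 0" if "i < d" for i
      using that unfolding ip_def by (simp add: sum_nonneg_eq_0_iff)
    moreover obtain x where "x \<in> A" using assms by blast
    ultimately show ?thesis using f(1) unfolding cone_over_def
      by (intro CollectI exI[of _ 0] exI[of _ x])
         (auto simp: fun_eq_iff restrict_def PiE_def extensional_def)
  next
    case False
    then show ?thesis using f nn unfolding cone_over_def
      by (intro CollectI exI[of _ "sqrt (ip d f f)"]
            exI[of _ "\<lambda>i\<in>{..<d}. f i / sqrt (ip d f f)"])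
         (auto simp: fun_eq_iff restrict_def PiE_def extensional_def)
  qed
qed

lemma normalize_in_sphere:
  assumes "sqrt (ip d f f) \<noteq> 0"
  shows "(\<lambda>i\<in>{..<d}. f i / sqrt (ip d f f)) \<in> unit_sphere d"
proof -
  have nn: "ip d f f \<ge> 0" by (auto simp: ip_def intro!: sum_nonneg)
  have "ip d (\<lambda>i\<in>{..<d}. f i / sqrt (ip d f f)) (\<lambda>i\<in>{..<d}. f i / sqrt (ip d f f)) =
      (\<Sum>i<d. (f i * f i) / (sqrt (ip d f f) * sqrt (ip d f f)))"
    unfolding ip_def[of d "\<lambda>i\<in>{..<d}. f i / sqrt (ip d f f)"] by (intro sum.cong) auto
  also have "\<dots> = ip d f f / (sqrt (ip d f f) * sqrt (ip d f f))"
    unfolding sum_divide_distrib[symmetric] by (simp add: ip_def)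
  also have "\<dots> = 1" using assms nn by simp
  finally show ?thesis by (simp add: unit_sphere_def euclid_def)
qed

lemma ip_pole: "d \<ge> 1 \<Longrightarrow> ip d (pole d) y = y 0"
proof -
  assume "d \<ge> 1"
  have "ip d (pole d) y = (\<Sum>i<d. if i = 0 then y i else 0)"
    unfolding ip_def pole_def by (intro sum.cong) auto
  then show ?thesis using \<open>d \<ge> 1\<close> by simp
qed

lemma pole_in_sphere: "d \<ge> 1 \<Longrightarrow> pole d \<in> unit_sphere d"
  using ip_pole[of d "pole d"] by (simp add: unit_sphere_def euclid_def pole_def)

lemma measure_cone_over_sphere:
  assumes "d \<ge> 1"
  shows "measure (PiM {..<d} (\<lambda>_. lborel)) (cone_over d (unit_sphere d)) = unit_ball_vol (real d)"
proof -
  have "cone_over d (unit_sphere d) =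
      {f. sqrt (\<Sum>i\<in>{..<d}. (f i)\<^sup>2) \<le> 1} \<inter> space (PiM {..<d} (\<lambda>_. lborel))"
    using normalize_in_sphere pole_in_sphere[OF assms]
    by (subst cone_over_subset_sphere)
       (auto simp: euclid_def space_PiM ip_def power2_eq_square)
  then show ?thesis using emeasure_cball_aux[of "{..<d}" 1] by (simp add: measure_def)
qed

lemma measure_cone_over_cap:
  assumes "n \<ge> 1" "0 < \<theta>" "\<theta> < pi / 2" "d = n + 1"
  shows "measure (PiM {..<d} (\<lambda>_. lborel)) (cone_over d (spherical_cap d \<theta> (pole d))) =
         unit_ball_vol (real n) * (n / (n + 1) * integral {0..\<theta>} (\<lambda>x. sin x ^ (n - 1)))"
proof -
  interpret product_sigma_finite "\<lambda>_::nat. lborel :: real measure" by standard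
  define A where "A = {1..<d}"
  have A: "finite A" "0 \<notin> A" "insert 0 A = {..<d}" "card A = n"
    using assms by (auto simp: A_def)
  define c where "c = cos \<theta>"
  have c: "0 < c" "c < 1"
    using assms cos_gt_zero[of \<theta>] cos_monotone_0_pi[of 0 \<theta>] by (auto simp: c_def)
  have t: "0 < tan \<theta>" using assms by (intro tan_gt_zero) auto
  have tc: "1 + (tan \<theta>)\<^sup>2 = 1 / c\<^sup>2"
    using tan_sec[of \<theta>] c by (simp add: c_def inverse_eq_divide power_divide)
  define M where "M = PiM (insert 0 A) (\<lambda>_. lborel :: real measure)"
  define K where "K = {f \<in> space M. (f 0)\<^sup>2 + (\<Sum>i\<in>A. (f i)\<^sup>2) \<le> 1 \<and>
     c * sqrt ((f 0)\<^sup>2 + (\<Sum>i\<in>A. (f i)\<^sup>2)) \<le> f 0}"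
  have comp: "(\<lambda>f. f i) \<in> borel_measurable M" if "i \<in> insert 0 A" for i
    using measurable_component_singleton[OF that, of "\<lambda>_. lborel :: real measure"]
    by (simp add: M_def)
  have [measurable]: "(\<lambda>f. f 0) \<in> borel_measurable M" by (rule comp) simp
  have [measurable]: "(\<lambda>f. \<Sum>i\<in>A. (f i)\<^sup>2) \<in> borel_measurable M"
    by (intro borel_measurable_sum borel_measurable_power[OF comp]) auto
  have "(\<lambda>f. (f 0)\<^sup>2 + (\<Sum>i\<in>A. (f i)\<^sup>2)) \<in> borel_measurable M" by measurable
  then have [measurable]: "{f \<in> space M. (f 0)\<^sup>2 + (\<Sum>i\<in>A. (f i)\<^sup>2) \<le> 1} \<in> sets M"
    "{f \<in> space M. c * sqrt ((f 0)\<^sup>2 + (\<Sum>i\<in>A. (f i)\<^sup>2)) \<le> f 0} \<in> sets M"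
    by (intro borel_measurable_le borel_measurable_const borel_measurable_times
        measurable_compose[OF _ borel_measurable_sqrt] comp; simp)+
  have "K = {f \<in> space M. (f 0)\<^sup>2 + (\<Sum>i\<in>A. (f i)\<^sup>2) \<le> 1} \<inter>
      {f \<in> space M. c * sqrt ((f 0)\<^sup>2 + (\<Sum>i\<in>A. (f i)\<^sup>2)) \<le> f 0}"
    unfolding K_def by auto
  then have Mm [measurable]: "K \<in> sets M" by (auto intro!: sets.Int)
  have ipA: "ip d f f = (f 0)\<^sup>2 + (\<Sum>i\<in>A. (f i)\<^sup>2)" for f
    unfolding ip_def A(3)[symmetric] sum.insert[OF A(1,2)] by (simp add: power2_eq_square)
  have capne: "spherical_cap d \<theta> (pole d) \<noteq> {}" "spherical_cap d \<theta> (pole d) \<subseteq> unit_sphere d"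
    using pole_in_sphere[of d] ip_pole[of d "pole d"] assms
    by (auto simp: spherical_cap_def pole_def)
  have "cone_over d (spherical_cap d \<theta> (pole d)) = K"
  proof (subst cone_over_subset_sphere[OF capne(2,1)], intro set_eqI iffI)
    fix f
    have nn: "ip d f f \<ge> 0" by (auto simp: ip_def intro!: sum_nonneg)
    have eq: "ip d (pole d) (\<lambda>i\<in>{..<d}. f i / sqrt (ip d f f)) = f 0 / sqrt (ip d f f)"
      using assms by (subst ip_pole) auto
    have z: "f 0 = 0" if "ip d f f = 0"
    proof -
      have "(\<Sum>i\<in>A. (f i)\<^sup>2) \<ge> 0" by (simp add: sum_nonneg)
      then have "(f 0)\<^sup>2 = 0" using that zero_le_power2[of "f 0"] unfolding ipA by linarith
      then show ?thesis by simp
    qed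
    have sp: "space M = euclid d" unfolding M_def A(3) by (simp add: space_PiM euclid_def)
    {
      assume "f \<in> {f \<in> euclid d. sqrt (ip d f f) \<le> 1 \<and> (sqrt (ip d f f) \<noteq> 0 \<longrightarrow>
          (\<lambda>i\<in>{..<d}. f i / sqrt (ip d f f)) \<in> spherical_cap d \<theta> (pole d))}"
      then show "f \<in> K"
        using eq z nn unfolding K_def ipA[symmetric] sp
        by (cases "ip d f f = 0") (auto simp: spherical_cap_def field_simps c_def)
    next
      assume "f \<in> K"
      then show "f \<in> {f \<in> euclid d. sqrt (ip d f f) \<le> 1 \<and> (sqrt (ip d f f) \<noteq> 0 \<longrightarrow>
          (\<lambda>i\<in>{..<d}. f i / sqrt (ip d f f)) \<in> spherical_cap d \<theta> (pole d))}"
        using eq nn normalize_in_sphere[of d f] unfolding K_def ipA[symmetric] sp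
        by (auto simp: spherical_cap_def field_simps c_def)
    }
  qed
  define m where "m y = min (sqrt (1 - y\<^sup>2)) (y * tan \<theta>)" for y
  have slice: "y\<^sup>2 + S \<le> 1 \<and> c * sqrt (y\<^sup>2 + S) \<le> y \<longleftrightarrow> y \<in> {0..1} \<and> sqrt S \<le> m y"
    if S: "S \<ge> 0" for y S :: real
  proof (cases "y \<in> {0..1}")
    case True
    have "c * sqrt (y\<^sup>2 + S) \<le> y \<longleftrightarrow> sqrt (y\<^sup>2 + S) \<le> y / c" using c by (simp add: field_simps)
    also have "\<dots> \<longleftrightarrow> y\<^sup>2 + S \<le> (y / c)\<^sup>2" using True c S by (intro real_sqrt_le_iff') auto
    also have "(y / c)\<^sup>2 = y\<^sup>2 * (1 + (tan \<theta>)\<^sup>2)" unfolding tc by (simp add: power_divide)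
    also have "y\<^sup>2 + S \<le> \<dots> \<longleftrightarrow> S \<le> (y * tan \<theta>)\<^sup>2" by (simp add: algebra_simps power_mult_distrib)
    also have "\<dots> \<longleftrightarrow> sqrt S \<le> y * tan \<theta>"
      using True t S by (intro real_sqrt_le_iff'[symmetric]) auto
    finally have 1: "c * sqrt (y\<^sup>2 + S) \<le> y \<longleftrightarrow> sqrt S \<le> y * tan \<theta>" .
    have 2: "y\<^sup>2 + S \<le> 1 \<longleftrightarrow> sqrt S \<le> sqrt (1 - y\<^sup>2)" by auto
    show ?thesis using 1 2 True by (auto simp: m_def)
  next
    case False
    have "\<not> (y\<^sup>2 + S \<le> 1 \<and> c * sqrt (y\<^sup>2 + S) \<le> y)"
    proof
      assume a: "y\<^sup>2 + S \<le> 1 \<and> c * sqrt (y\<^sup>2 + S) \<le> y"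
      then have "y\<^sup>2 \<le> 1" using S by linarith
      then have "\<bar>y\<bar> \<le> 1" by (simp add: abs_square_le_1)
      moreover have "0 \<le> c * sqrt (y\<^sup>2 + S)" using c S by simp
      ultimately show False using a False by auto
    qed
    then show ?thesis using False by blast
  qed
  have "emeasure M K = (\<integral>\<^sup>+ f. indicator K f \<partial>M)" by simp
  also have "\<dots> = (\<integral>\<^sup>+ y. \<integral>\<^sup>+ x. indicator K (x(0 := y)) \<partial>PiM A (\<lambda>_. lborel) \<partial>lborel)"
    unfolding M_def using Mm by (subst product_nn_integral_insert_rev[OF A(1,2)]) (auto simp: M_def)
  also have "\<dots> = (\<integral>\<^sup>+ y. \<integral>\<^sup>+ x. indicator {0..1} y *
      indicator ({f. sqrt (\<Sum>i\<in>A. (f i)\<^sup>2) \<le> m y} \<inter> space (PiM A (\<lambda>_. lborel))) x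
      \<partial>PiM A (\<lambda>_. lborel) \<partial>lborel)"
  proof (intro nn_integral_cong)
    fix y :: real and x assume x: "x \<in> space (PiM A (\<lambda>_. lborel :: real measure))"
    have sm: "(\<Sum>i\<in>A. ((x(0 := y)) i)\<^sup>2) = (\<Sum>i\<in>A. (x i)\<^sup>2)"
      using A by (intro sum.cong) auto
    have "x(0 := y) \<in> space M" using x by (auto simp: M_def space_PiM PiE_def extensional_def)
    then have "x(0 := y) \<in> K \<longleftrightarrow> y \<in> {0..1} \<and> sqrt (\<Sum>i\<in>A. (x i)\<^sup>2) \<le> m y"
      unfolding K_def using slice[of "\<Sum>i\<in>A. (x i)\<^sup>2" y] sm by (simp add: sum_nonneg)
    then show "indicator K (x(0 := y)) = indicator {0..1} y *
      (indicator ({f. sqrt (\<Sum>i\<in>A. (f i)\<^sup>2) \<le> m y} \<inter> space (PiM A (\<lambda>_. lborel))) x :: ennreal)"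
      using x by (auto simp: indicator_def)
  qed
  also have "\<dots> = (\<integral>\<^sup>+ y. indicator {0..1} y * emeasure (PiM A (\<lambda>_. lborel))
      ({f. sqrt (\<Sum>i\<in>A. (f i)\<^sup>2) \<le> m y} \<inter> space (PiM A (\<lambda>_. lborel))) \<partial>lborel)"
  proof (rule nn_integral_cong)
    fix y :: real
    have compA: "(\<lambda>f. f i) \<in> borel_measurable (PiM A (\<lambda>_. lborel :: real measure))"
      if "i \<in> A" for i
      using measurable_component_singleton[OF that, of "\<lambda>_. lborel :: real measure"] by simp
    have "(\<lambda>f. \<Sum>i\<in>A. (f i)\<^sup>2) \<in> borel_measurable (PiM A (\<lambda>_. lborel :: real measure))"
      by (intro borel_measurable_sum borel_measurable_power[OF compA])
    from measurable_compose[OF this borel_measurable_sqrt]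
    have "{f \<in> space (PiM A (\<lambda>_. lborel)). sqrt (\<Sum>i\<in>A. (f i)\<^sup>2) \<le> m y}
        \<in> sets (PiM A (\<lambda>_. lborel))"
      by (rule borel_measurable_le) simp
    then have ms: "{f. sqrt (\<Sum>i\<in>A. (f i)\<^sup>2) \<le> m y} \<inter> space (PiM A (\<lambda>_. lborel))
        \<in> sets (PiM A (\<lambda>_. lborel))"
      by (simp add: Collect_conj_eq Int_commute)
    show "(\<integral>\<^sup>+ x. indicator {0..1} y *
        indicator ({f. sqrt (\<Sum>i\<in>A. (f i)\<^sup>2) \<le> m y} \<inter> space (PiM A (\<lambda>_. lborel))) x
        \<partial>PiM A (\<lambda>_. lborel)) = indicator {0..1} y * emeasure (PiM A (\<lambda>_. lborel))
        ({f. sqrt (\<Sum>i\<in>A. (f i)\<^sup>2) \<le> m y} \<inter> space (PiM A (\<lambda>_. lborel)))"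
      by (rule nn_integral_cmult_indicator[OF ms])
  qed
  also have "\<dots> = (\<integral>\<^sup>+ y. ennreal (unit_ball_vol (real n) * m y ^ n) * indicator {0..1} y \<partial>lborel)"
  proof (intro nn_integral_cong_AE)
    have "AE y in lborel. y \<notin> {0, 1::real}"
      by (intro AE_not_in countable_imp_null_set_lborel) auto
    then show "AE y in lborel. indicator {0..1} y * emeasure (PiM A (\<lambda>_. lborel))
      ({f. sqrt (\<Sum>i\<in>A. (f i)\<^sup>2) \<le> m y} \<inter> space (PiM A (\<lambda>_. lborel))) =
      ennreal (unit_ball_vol (real n) * m y ^ n) * indicator {0..1} y"
    proof eventually_elim
      case (elim y)
      show ?case
      proof (cases "y \<in> {0<..<1}")
        case True
        have "y\<^sup>2 < 1" using True by (simp add: abs_square_less_1)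
        then have "m y > 0" unfolding m_def using True t by simp
        from emeasure_cball_aux[OF A(1) this] show ?thesis by (simp add: A mult_ac)
      qed (use elim in \<open>auto simp: indicator_def\<close>)
    qed
  qed
  also have "\<dots> = ennreal (unit_ball_vol (real n) *
      (n / (n + 1) * integral {0..\<theta>} (\<lambda>x. sin x ^ (n - 1))))"
  proof (rule nn_integral_has_integral_lebesgue')
    show "((\<lambda>y. unit_ball_vol (real n) * m y ^ n) has_integral unit_ball_vol (real n) *
      (n / (n + 1) * integral {0..\<theta>} (\<lambda>x. sin x ^ (n - 1)))) {0..1}"
      unfolding m_def by (intro has_integral_mult_right has_integral_cap_profile assms)
    show "0 \<le> unit_ball_vol (real n) * m y ^ n" if "y \<in> {0..1}" for y
    proof -
      have "y\<^sup>2 \<le> 1" using that by (simp add: abs_square_le_1)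
      then have "0 \<le> m y" using that t by (simp add: m_def)
      then show ?thesis by simp
    qed
  qed
  finally have "emeasure M K = ennreal (unit_ball_vol (real n) *
      (n / (n + 1) * integral {0..\<theta>} (\<lambda>x. sin x ^ (n - 1))))" .
  moreover have "0 \<le> integral {0..\<theta>} (\<lambda>x. sin x ^ (n - 1))"
    using assms by (intro integral_nonneg integrable_continuous_real continuous_intros)
      (auto intro!: zero_le_power sin_ge_zero)
  ultimately show ?thesis
    unfolding \<open>cone_over d (spherical_cap d \<theta> (pole d)) = K\<close> A(3)[symmetric]
    by (simp add: measure_def M_def)
qed

theorem cap_area_eq:
  assumes "d \<ge> 2" "0 < \<theta>" "\<theta> < pi / 2"
  shows "cap_area d \<theta> = 1 / sqrt pi * (Gamma (real d / 2) / Gamma ((real d - 1) / 2)) *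
           integral {0..\<theta>} (\<lambda>x. sin x ^ (d - 2))"
proof -
  define n where "n = d - 1"
  have n: "n \<ge> 1" "d = n + 1" using assms by (auto simp: n_def)
  define I where "I = integral {0..\<theta>} (\<lambda>x. sin x ^ (n - 1))"
  have g1: "Gamma (real n / 2 + 1) = real n / 2 * Gamma (real n / 2)"
    using Gamma_plus1[of "real n / 2"] n nonpos_Ints_nonpos[of "real n / 2"]
    by (auto simp: add_ac)
  have g2: "Gamma (real d / 2 + 1) = real d / 2 * Gamma (real d / 2)"
    using Gamma_plus1[of "real d / 2"] n nonpos_Ints_nonpos[of "real d / 2"]
    by (auto simp: add_ac)
  have pos: "Gamma (real n / 2) > 0" "Gamma (real d / 2) > 0" using n by auto
  have p: "pi powr (real d / 2) = pi powr (real n / 2) * sqrt pi"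
    unfolding n by (simp add: add_divide_distrib powr_add powr_half_sqrt)
  have "cap_area d \<theta> = unit_ball_vol (real n) * (n / (n + 1) * I) / unit_ball_vol (real d)"
    using measure_cone_over_cap[OF n(1) assms(2,3) n(2)] measure_cone_over_sphere[of d] n
    by (simp add: cap_area_def sphere_area_def I_def)
  also have "n + 1 = d" using n by simp
  also have "unit_ball_vol (real n) * (real n / real d * I) / unit_ball_vol (real d) =
      1 / sqrt pi * (Gamma (real d / 2) / Gamma (real n / 2)) * I"
  proof -
    have "real n > 0" "real d > 0" using n by auto
    moreover have "P / (a / 2 * Ga) * (a / b * I) / (P * w / (b / 2 * Gb)) = 1 / w * (Gb / Ga) * I"
      if "a > 0" "b > 0" "Ga > 0" "Gb > 0" "P > 0" "w > 0" for P w a b Ga Gb :: real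
      using that by (simp add: field_simps)
    ultimately show ?thesis unfolding unit_ball_vol_def g1 g2 p using pos by (simp add: mult_ac)
  qed
  finally show ?thesis using n by (simp add: I_def)
qed

end

theory Submission
  imports Defs "HOL-Real_Asymp.Real_Asymp"
begin

text \<open>
  The proof analyses a random spherical code. In the hard-core model of activity \<open>l\<close> a code \<open>I\<close> is drawn with
  density proportional to \<open>l ^ card I\<close>, and its expected size \<open>\<alpha>\<close> is a lower bound for the largest size.
  Write \<open>s\<close> for the area of a cap of radius \<open>\<theta>\<close>, and look at such a cap around a uniformly random point
  \<open>x\<close> of the sphere. Let \<open>T\<close> be the part of the cap that is not excluded by the points of the code outside the cap, and
  let \<open>Z T\<close> be the partition function of \<open>T\<close>. Conditionally on \<open>T\<close>, the code inside the cap is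
  a hard-core sample of \<open>T\<close>. This has two consequences.

  \<^item> The point \<open>x\<close> can be added to the code exactly if the cap is empty, which has probability \<open>1 / Z T\<close>. So
    \<open>\<alpha>\<close> is the expectation of \<open>l / Z T\<close>.

  \<^item> The expected number of points in the cap is \<open>s * \<alpha>\<close>. On the other hand, two points of \<open>T\<close> at angle
    less than \<open>\<theta>\<close> are such that the one closer to \<open>x\<close> lies in a cap of radius \<open>q_angle \<theta>\<close> determined by \<open>x\<close>
    and the other one. If \<open>Q\<close> is the area of this small cap, a random point of \<open>T\<close> therefore conflicts on
    average with area at most \<open>2 * Q\<close>, and this makes the expected number at least
    \<open>exp (- 2 * l * Q)\<close> times the expectation of \<open>ln (Z T)\<close>.

  If \<open>Z T\<close> is small the first point gives a large code, and if it is large the second one does. With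
  \<open>l = 1 / (d * Q)\<close> the factor \<open>exp (- 2 * l * Q)\<close> tends to \<open>1\<close>, and the two bounds balance at \<open>ln (Z T)\<close>
  about \<open>ln (s / Q)\<close>, which is asymptotic to \<open>d\<close> times \<open>ln (sin \<theta> / sin (q_angle \<theta>)) = c_const \<theta>\<close>. This
  yields the claimed \<open>c_const \<theta> * d / s\<close>.

  The model is defined here on a finite graph, for which \<open>large_stable_set\<close> is the precise form of the
  argument. The lemma \<open>discrete_sphere\<close> supplies finite weighted point sets that approximate the sphere,
  and \<open>cap_intersection\<close> the geometry of the small cap. The caps that occur have arbitrary centres; by
  \<open>measure_cap_cone\<close>, which rests on the rotation invariance of Lebesgue measure, their area depends only
  on the radius. The error of the discretisation vanishes in \<open>code_size_bound\<close>.
\<close>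

section \<open>The hard-core model on a finite graph\<close>

definition stable_sets :: "('a \<Rightarrow> 'a \<Rightarrow> bool) \<Rightarrow> 'a set \<Rightarrow> 'a set set" where
  "stable_sets R U = {I. I \<subseteq> U \<and> (\<forall>x\<in>I. \<forall>y\<in>I. x \<noteq> y \<longrightarrow> \<not> R x y)}"

lemma finite_stable_sets: "finite U \<Longrightarrow> finite (stable_sets R U)"
  by (rule finite_subset[of _ "Pow U"]) (auto simp: stable_sets_def)

lemma stable_sets_mono: "U \<subseteq> U' \<Longrightarrow> stable_sets R U \<subseteq> stable_sets R U'"
  by (auto simp: stable_sets_def)

lemma empty_stable: "{} \<in> stable_sets R U"
  by (simp add: stable_sets_def)

text \<open>
  The convex function \<open>\<lambda>x. exp (- x)\<close> lies above its tangent at \<open>m\<close>. Averaged over \<open>x\<close>, this linear bound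
  takes the place of Jensen's inequality.
\<close>

lemma exp_tangent: "exp (- m) * (1 + m - x) \<le> exp (- x)" for m x :: real
proof -
  have "exp (- m) * (1 + (m - x)) \<le> exp (- m) * exp (m - x)"
    by (intro mult_left_mono exp_ge_add_one_self) simp
  then show ?thesis by (simp add: exp_add[symmetric] algebra_simps)
qed

text \<open>
  The hard-core model with activities \<open>a\<close>: a stable set \<open>I\<close> of a finite graph \<open>U\<close> is drawn with probability
  \<open>prod a I / Z U\<close>. Everything is phrased with the unnormalised sums, so \<open>Z1 U / Z U\<close> is the expected
  size of the random stable set. The relation \<open>R\<close> is adjacency together with equality, so that
  \<open>{v. R u v}\<close> is a closed neighbourhood.
\<close>

locale hard_core =
  fixes R :: "'a \<Rightarrow> 'a \<Rightarrow> bool" and a :: "'a \<Rightarrow> real"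
  assumes R_sym: "R x y \<Longrightarrow> R y x"
    and a_nonneg: "0 \<le> a x"
begin

definition Z :: "'a set \<Rightarrow> real" where
  "Z U = (\<Sum>I\<in>stable_sets R U. prod a I)"

definition Z1 :: "'a set \<Rightarrow> real" where
  "Z1 U = (\<Sum>I\<in>stable_sets R U. real (card I) * prod a I)"

lemma prod_a_nonneg: "0 \<le> prod a I"
  by (simp add: prod_nonneg a_nonneg)

lemma Z_ge_1: "finite U \<Longrightarrow> 1 \<le> Z U"
  unfolding Z_def
  using member_le_sum[of "{}" "stable_sets R U" "prod a"]
  by (simp add: empty_stable finite_stable_sets prod_a_nonneg)

lemma Z_mono: "finite U' \<Longrightarrow> U \<subseteq> U' \<Longrightarrow> Z U \<le> Z U'"
  unfolding Z_def
  by (intro sum_mono2 finite_stable_sets stable_sets_mono prod_a_nonneg)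

text \<open>
  The vertices of \<open>B\<close> that remain available once the random set is known to be \<open>J\<close> outside \<open>B\<close>.
\<close>

definition unblocked :: "'a set \<Rightarrow> 'a set \<Rightarrow> 'a set" where
  "unblocked B J = {u \<in> B. \<forall>y\<in>J. \<not> R u y}"

text \<open>
  The spatial Markov property: given the part \<open>J\<close> of the random stable set outside \<open>B\<close>, its part inside
  \<open>B\<close> is a sample of the hard-core model on the unblocked vertices.
\<close>

lemma sum_split:
  assumes "finite U"
  shows "(\<Sum>I\<in>stable_sets R U. f (I \<inter> B) * prod a I) =
    (\<Sum>J\<in>stable_sets R (U - B). prod a J *
       (\<Sum>K\<in>stable_sets R (unblocked (U \<inter> B) J). f K * prod a K))"
proof -
  have fin: "finite I" if "I \<in> stable_sets R U" for I
    using that assms finite_subset by (auto simp: stable_sets_def)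
  have "(\<Sum>J\<in>stable_sets R (U - B). prod a J *
       (\<Sum>K\<in>stable_sets R (unblocked (U \<inter> B) J). f K * prod a K)) =
    (\<Sum>(J, K)\<in>Sigma (stable_sets R (U - B)) (\<lambda>J. stable_sets R (unblocked (U \<inter> B) J)).
       prod a J * (f K * prod a K))"
    using assms by (subst sum.Sigma[symmetric])
      (auto simp: sum_distrib_left unblocked_def intro!: finite_stable_sets)
  also have "\<dots> = (\<Sum>I\<in>stable_sets R U. f (I \<inter> B) * prod a I)"
  proof (rule sum.reindex_bij_witness[where
        j = "\<lambda>(J, K). J \<union> K" and i = "\<lambda>I. (I - B, I \<inter> B)"])
    fix p
    assume p: "p \<in> Sigma (stable_sets R (U - B)) (\<lambda>J. stable_sets R (unblocked (U \<inter> B) J))"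
    obtain J K where [simp]: "p = (J, K)" by (cases p)
    have J: "J \<in> stable_sets R (U - B)" and K: "K \<in> stable_sets R (unblocked (U \<inter> B) J)"
      using p by auto
    have JK: "J \<subseteq> U - B" "K \<subseteq> U \<inter> B" "\<And>u y. u \<in> K \<Longrightarrow> y \<in> J \<Longrightarrow> \<not> R u y"
      using J K unfolding stable_sets_def unblocked_def by auto
    show "(\<lambda>I. (I - B, I \<inter> B)) ((\<lambda>(J, K). J \<union> K) p) = p" using JK by auto
    have "\<And>u y. u \<in> K \<Longrightarrow> y \<in> J \<Longrightarrow> \<not> R y u" using JK(3) R_sym by blast
    then show st: "(\<lambda>(J, K). J \<union> K) p \<in> stable_sets R U"
      using J K JK unfolding stable_sets_def by auto
    have "prod a (J \<union> K) = prod a J * prod a K"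
      using JK st fin by (intro prod.union_disjoint) auto
    moreover have "(J \<union> K) \<inter> B = K" using JK by auto
    ultimately show "f ((\<lambda>(J, K). J \<union> K) p \<inter> B) * prod a ((\<lambda>(J, K). J \<union> K) p) =
        (case p of (J, K) \<Rightarrow> prod a J * (f K * prod a K))"
      by simp
  next
    fix I assume I: "I \<in> stable_sets R U"
    show "(\<lambda>(J, K). J \<union> K) ((\<lambda>I. (I - B, I \<inter> B)) I) = I" by auto
    show "(\<lambda>I. (I - B, I \<inter> B)) I
        \<in> Sigma (stable_sets R (U - B)) (\<lambda>J. stable_sets R (unblocked (U \<inter> B) J))"
      using I unfolding stable_sets_def unblocked_def by auto
  qed
  finally show ?thesis by simp
qed

lemma Z_split:
  assumes "finite U"
  shows "Z U = (\<Sum>J\<in>stable_sets R (U - B). prod a J * Z (unblocked (U \<inter> B) J))"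
  using sum_split[OF assms, of "\<lambda>_. 1" B] by (simp add: Z_def)

lemma Z_submult:
  assumes "finite U"
  shows "Z U \<le> Z (U - B) * Z (U \<inter> B)"
proof -
  have "Z U \<le> (\<Sum>J\<in>stable_sets R (U - B). prod a J * Z (U \<inter> B))"
    unfolding Z_split[OF assms, of B] using assms
    by (intro sum_mono mult_left_mono Z_mono prod_a_nonneg) (auto simp: unblocked_def)
  then show ?thesis by (simp add: Z_def sum_distrib_right)
qed

lemma Z_le_exp:
  assumes "finite U"
  shows "Z U \<le> exp (sum a U)"
  using assms
proof (induction U rule: finite_induct)
  case empty
  have "stable_sets R {} = {{}}" by (auto simp: stable_sets_def)
  then show ?case by (simp add: Z_def)
next
  case (insert u U)
  have "stable_sets R {u} = {{}, {u}}" by (auto simp: stable_sets_def)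
  then have "Z {u} = 1 + a u" by (simp add: Z_def)
  then have u: "Z {u} \<le> exp (a u)" by (simp add: exp_ge_add_one_self)
  have "Z (insert u U) \<le> Z (insert u U - {u}) * Z (insert u U \<inter> {u})"
    using insert by (intro Z_submult) auto
  also have "\<dots> = Z U * Z {u}" using insert by simp
  also have "\<dots> \<le> exp (sum a U) * exp (a u)"
    using insert u Z_ge_1[of "{u}"] by (intro mult_mono) auto
  finally show ?case using insert by (simp add: exp_add mult.commute)
qed

text \<open>
  A stable set through \<open>u\<close> is \<open>u\<close> together with a stable set that avoids the closed neighbourhood
  of \<open>u\<close>. Summed over \<open>u\<close>, this expresses the expected size through ratios of partition functions.
\<close>

lemma sum_containing:
  assumes "finite U" "u \<in> U" "R u u"
  shows "(\<Sum>I\<in>{I \<in> stable_sets R U. u \<in> I}. prod a I) = a u * Z (U - {v. R u v})"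
proof -
  have "(\<Sum>I\<in>{I \<in> stable_sets R U. u \<in> I}. prod a I) =
      (\<Sum>J\<in>stable_sets R (U - {v. R u v}). a u * prod a J)"
  proof (rule sum.reindex_bij_witness[where i = "insert u" and j = "\<lambda>I. I - {u}"])
    fix I assume I: "I \<in> {I \<in> stable_sets R U. u \<in> I}"
    then show "insert u (I - {u}) = I" by auto
    show "I - {u} \<in> stable_sets R (U - {v. R u v})"
      using I by (auto simp: stable_sets_def)
    have "finite I" using I assms finite_subset by (auto simp: stable_sets_def)
    then show "a u * prod a (I - {u}) = prod a I" using I by (simp add: prod.remove[of I u])
  next
    fix J assume J: "J \<in> stable_sets R (U - {v. R u v})"
    then show "insert u J - {u} = J" using assms by (auto simp: stable_sets_def)
    show "insert u J \<in> {I \<in> stable_sets R U. u \<in> I}"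
      using J assms R_sym by (auto simp: stable_sets_def)
  qed
  then show ?thesis by (simp add: Z_def sum_distrib_left)
qed

lemma card_weighted:
  assumes "finite U"
  shows "(\<Sum>I\<in>stable_sets R U. real (card (I \<inter> B)) * prod a I) =
    (\<Sum>u\<in>U \<inter> B. \<Sum>I\<in>{I \<in> stable_sets R U. u \<in> I}. prod a I)"
proof -
  have "(\<Sum>I\<in>stable_sets R U. real (card (I \<inter> B)) * prod a I) =
      (\<Sum>I\<in>stable_sets R U. \<Sum>u\<in>U \<inter> B. if u \<in> I then prod a I else 0)"
  proof (intro sum.cong refl)
    fix I assume "I \<in> stable_sets R U"
    then have "U \<inter> B \<inter> I = I \<inter> B" by (auto simp: stable_sets_def)
    then show "real (card (I \<inter> B)) * prod a I = (\<Sum>u\<in>U \<inter> B. if u \<in> I then prod a I else 0)"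
      using assms by (simp add: sum.If_cases)
  qed
  also have "\<dots> = (\<Sum>u\<in>U \<inter> B. \<Sum>I\<in>stable_sets R U. if u \<in> I then prod a I else 0)"
    by (rule sum.swap)
  also have "\<dots> = (\<Sum>u\<in>U \<inter> B. \<Sum>I\<in>{I \<in> stable_sets R U. u \<in> I}. prod a I)"
    using assms by (intro sum.cong refl sum.inter_filter[symmetric] finite_stable_sets)
  finally show ?thesis .
qed

lemma Z1_eq:
  assumes "finite U" "\<And>u. u \<in> U \<Longrightarrow> R u u"
  shows "Z1 U = (\<Sum>u\<in>U. a u * Z (U - {v. R u v}))"
proof -
  have "Z1 U = (\<Sum>I\<in>stable_sets R U. real (card (I \<inter> U)) * prod a I)"
    unfolding Z1_def by (intro sum.cong refl) (auto simp: stable_sets_def Int_absorb2)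
  also have "\<dots> = (\<Sum>u\<in>U. \<Sum>I\<in>{I \<in> stable_sets R U. u \<in> I}. prod a I)"
    using card_weighted[OF assms(1), of U] by simp
  also have "\<dots> = (\<Sum>u\<in>U. a u * Z (U - {v. R u v}))"
    using assms by (intro sum.cong refl sum_containing) auto
  finally show ?thesis .
qed

text \<open>
  On a sparse graph, where a random vertex sees on average activity at most \<open>m\<close> in its neighbourhood, the
  expected size is at least \<open>exp (- m)\<close> times \<open>ln (Z U)\<close>. Indeed the vertex \<open>u\<close> is available with probability
  \<open>Z (U - {v. R u v}) / Z U\<close>, which by submultiplicativity is at least
  \<open>exp (- sum a (U \<inter> {v. R u v}))\<close>; Jensen's inequality averages this over \<open>u\<close>, and the total activity
  bounds \<open>ln (Z U)\<close>.
\<close>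

lemma Z1_lower:
  assumes "finite U" "\<And>u. u \<in> U \<Longrightarrow> R u u"
    and sparse: "(\<Sum>u\<in>U. a u * sum a (U \<inter> {v. R u v})) \<le> m * sum a U"
  shows "exp (- m) * ln (Z U) * Z U \<le> Z1 U"
proof -
  have Zpos: "0 < Z U" using Z_ge_1[OF assms(1)] by linarith
  define x where "x u = sum a (U \<inter> {v. R u v})" for u
  have "ln (Z U) \<le> sum a U"
    using Z_le_exp[OF assms(1)] Zpos ln_le_cancel_iff[of "Z U" "exp (sum a U)"] by simp
  then have "exp (- m) * ln (Z U) \<le> exp (- m) * sum a U"
    by (intro mult_left_mono) auto
  also have "\<dots> \<le> exp (- m) * ((1 + m) * sum a U - (\<Sum>u\<in>U. a u * x u))"
    using sparse by (intro mult_left_mono) (auto simp: x_def algebra_simps)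
  also have "\<dots> = (\<Sum>u\<in>U. a u * (exp (- m) * (1 + m - x u)))"
    by (simp add: sum_distrib_left sum_subtractf[symmetric] algebra_simps)
  also have "\<dots> \<le> (\<Sum>u\<in>U. a u * exp (- x u))"
    by (intro sum_mono mult_left_mono exp_tangent a_nonneg)
  finally have 1: "exp (- m) * ln (Z U) \<le> (\<Sum>u\<in>U. a u * exp (- x u))" .
  have 2: "exp (- x u) * Z U \<le> Z (U - {v. R u v})" for u
  proof -
    have "Z U \<le> Z (U - {v. R u v}) * Z (U \<inter> {v. R u v})"
      by (rule Z_submult[OF assms(1)])
    also have "\<dots> \<le> Z (U - {v. R u v}) * exp (x u)"
      unfolding x_def using assms(1) Z_ge_1[of "U - {v. R u v}"]
      by (intro mult_left_mono Z_le_exp) auto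
    finally show ?thesis by (simp add: exp_minus field_simps)
  qed
  have "(\<Sum>u\<in>U. a u * (exp (- x u) * Z U)) \<le> (\<Sum>u\<in>U. a u * Z (U - {v. R u v}))"
    by (intro sum_mono mult_left_mono a_nonneg 2)
  also have "\<dots> = Z1 U" by (rule Z1_eq[OF assms(1,2), symmetric])
  finally have "(\<Sum>u\<in>U. a u * (exp (- x u) * Z U)) \<le> Z1 U" .
  moreover have "exp (- m) * ln (Z U) * Z U \<le> (\<Sum>u\<in>U. a u * (exp (- x u) * Z U))"
    using mult_right_mono[OF 1, of "Z U"] Zpos by (simp add: sum_distrib_right mult.assoc)
  ultimately show ?thesis by linarith
qed

text \<open>
  If the random stable set is small on average, then \<open>Z U\<close> is small, hence the empty set has a
  large probability \<open>1 / Z U\<close>. The parameter \<open>W\<close> is the value of \<open>ln (Z U)\<close> at which this is linearised.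
\<close>

lemma local_tradeoff:
  assumes "finite U" "\<And>u. u \<in> U \<Longrightarrow> R u u"
    and sparse: "(\<Sum>u\<in>U. a u * sum a (U \<inter> {v. R u v})) \<le> m * sum a U"
  shows "exp (- W) * ((1 + W) * Z U - exp m * Z1 U) \<le> 1"
proof -
  have Zpos: "0 < Z U" using Z_ge_1[OF assms(1)] by linarith
  have "exp m * (exp (- m) * ln (Z U) * Z U) \<le> exp m * Z1 U"
    by (intro mult_left_mono Z1_lower assms) auto
  then have "ln (Z U) * Z U \<le> exp m * Z1 U" by (simp add: exp_minus field_simps)
  then have "exp (- W) * ((1 + W) * Z U - exp m * Z1 U)
      \<le> exp (- W) * ((1 + W) * Z U - ln (Z U) * Z U)"
    by (intro mult_left_mono) auto
  also have "\<dots> = exp (- W) * (1 + W - ln (Z U)) * Z U" by (simp add: algebra_simps)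
  also have "\<dots> \<le> exp (- ln (Z U)) * Z U"
    using Zpos by (intro mult_right_mono exp_tangent) auto
  also have "\<dots> = 1" using Zpos by (simp add: exp_minus)
  finally show ?thesis .
qed

text \<open>
  The same tradeoff inside a neighbourhood \<open>B\<close> of a larger graph, averaged over the configuration
  outside \<open>B\<close> by the spatial Markov property: either \<open>B\<close> contains many points of the random set on average, or
  it is often empty.
\<close>

lemma global_tradeoff:
  assumes "finite V" "\<And>u. u \<in> V \<Longrightarrow> R u u" 
    and sparse: "\<And>U. U \<subseteq> V \<inter> B \<Longrightarrow> (\<Sum>u\<in>U. a u * sum a (U \<inter> {v. R u v})) \<le> m * sum a U"
  shows "exp (- W) * ((1 + W) * Z V - exp m * (\<Sum>I\<in>stable_sets R V. real (card (I \<inter> B)) * prod a I))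
     \<le> Z (V - B)"
proof -
  let ?T = "unblocked (V \<inter> B)"
  have T: "?T J \<subseteq> V \<inter> B" for J by (auto simp: unblocked_def)
  have "(\<Sum>I\<in>stable_sets R V. real (card (I \<inter> B)) * prod a I)
      = (\<Sum>J\<in>stable_sets R (V - B). prod a J * Z1 (?T J))"
    using sum_split[OF assms(1), of "\<lambda>K. real (card K)" B] by (simp add: Z1_def)
  then have "exp (- W) * ((1 + W) * Z V -
        exp m * (\<Sum>I\<in>stable_sets R V. real (card (I \<inter> B)) * prod a I)) =
      (\<Sum>J\<in>stable_sets R (V - B). prod a J *
        (exp (- W) * ((1 + W) * Z (?T J) - exp m * Z1 (?T J))))"
    unfolding Z_split[OF assms(1), of B]
    by (simp add: sum_distrib_left sum_subtractf[symmetric] algebra_simps)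
  also have "\<dots> \<le> (\<Sum>J\<in>stable_sets R (V - B). prod a J * 1)"
  proof (intro sum_mono mult_left_mono local_tradeoff sparse T prod_a_nonneg)
    fix J
    show "finite (?T J)" using T assms(1) by (meson finite_Int finite_subset)
    show "R u u" if "u \<in> ?T J" for u using that T assms(2) by blast
  qed
  finally show ?thesis by (simp add: Z_def)
qed

text \<open>
  To bound the average activity in a neighbourhood it is enough to look at the neighbours that
  come later in an ordering \<open>h\<close>, at the cost of a factor 2.
\<close>

lemma ordered_sparse:
  fixes h :: "'a \<Rightarrow> real"
  assumes "finite U"
    and Q: "\<And>u. u \<in> U \<Longrightarrow> sum a {v \<in> U. R u v \<and> h u \<le> h v} \<le> Q"
  shows "(\<Sum>u\<in>U. a u * sum a (U \<inter> {v. R u v})) \<le> 2 * Q * sum a U"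
proof -
  define g where "g u v = (if R u v \<and> h u \<le> h v then a u * a v else 0)" for u v
  have "(\<Sum>u\<in>U. a u * sum a (U \<inter> {v. R u v})) =
      (\<Sum>u\<in>U. \<Sum>v\<in>U. if R u v then a u * a v else 0)"
    using assms(1) by (simp add: sum_distrib_left sum.If_cases)
  also have "\<dots> \<le> (\<Sum>u\<in>U. \<Sum>v\<in>U. g u v + g v u)"
    using R_sym by (intro sum_mono) (auto simp: g_def a_nonneg)
  also have "\<dots> = 2 * (\<Sum>u\<in>U. \<Sum>v\<in>U. g u v)"
    using sum.swap[of "\<lambda>u v. g v u" U U] by (simp add: sum.distrib)
  also have "(\<Sum>u\<in>U. \<Sum>v\<in>U. g u v) = (\<Sum>u\<in>U. a u * sum a {v \<in> U. R u v \<and> h u \<le> h v})"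
    using assms(1) by (auto simp: g_def sum_distrib_left sum.inter_filter intro!: sum.cong)
  also have "\<dots> \<le> (\<Sum>u\<in>U. a u * Q)"
    by (intro sum_mono mult_left_mono Q a_nonneg)
  also have "(\<Sum>u\<in>U. a u * Q) = sum a U * Q" by (rule sum_distrib_right[symmetric])
  finally show ?thesis by (simp add: mult.commute[of _ Q])
qed

end

text \<open>
  The graph-theoretic core. The expected size \<open>Z1 V / Z V\<close> is controlled in two ways. It is \<open>l\<close> times
  the \<open>w\<close>-average over \<open>x\<close> of the probability that the neighbourhood of \<open>x\<close> is empty; and it is at least
  \<open>1 / D\<close> times the average over \<open>x\<close> of the expected number of points in the neighbourhood of \<open>x\<close>, by
  double counting. By the tradeoff these two averages cannot both be small.
\<close>

theorem large_stable_set: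
  fixes R :: "'a \<Rightarrow> 'a \<Rightarrow> bool" and w :: "'a \<Rightarrow> real" and h :: "'a \<Rightarrow> 'a \<Rightarrow> real"
  assumes V: "finite V"
    and sym: "\<And>x y. R x y \<Longrightarrow> R y x" and rf: "\<And>x. x \<in> V \<Longrightarrow> R x x"
    and w: "\<And>x. 0 \<le> w x" "sum w V = 1"
    and D: "\<And>x. x \<in> V \<Longrightarrow> sum w {u \<in> V. R x u} \<le> D"
    and Q: "\<And>x u. x \<in> V \<Longrightarrow> u \<in> V \<Longrightarrow> R x u \<Longrightarrow>
              sum w {v \<in> V. R x v \<and> R u v \<and> h x u \<le> h x v} \<le> Q"
    and l: "0 < l"
  obtains I where "I \<in> stable_sets R V"
    "l * exp (- W) * (1 + W) \<le> real (card I) * (1 + l * exp (- W) * exp (2 * (l * Q)) * D)"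
proof -
  interpret hard_core R "\<lambda>x. l * w x"
    using sym w l by unfold_locales auto
  let ?a = "\<lambda>x. l * w x"
  define m where "m = 2 * (l * Q)"
  define b where "b = l * exp (- W)"
  have b: "0 < b" using l by (simp add: b_def)
  have Zpos: "0 < Z V" using Z_ge_1[OF V] by linarith
  have "V \<noteq> {}" using w(2) by auto
  then obtain x0 where "x0 \<in> V" by auto
  have D0: "0 \<le> D" using D[OF \<open>x0 \<in> V\<close>] sum_nonneg[of "{u \<in> V. R x0 u}" w, OF w(1)] by linarith
  have nbr: "{x \<in> V. R x u} = {x \<in> V. R u x}" for u using sym by blast
  define S where "S x = (\<Sum>I\<in>stable_sets R V. real (card (I \<inter> {u. R x u})) * prod ?a I)" for x
  \<comment> \<open>\<open>S x\<close> is the unnormalised expected number of points in the neighbourhood of \<open>x\<close>.\<close>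
  have step: "exp (- W) * ((1 + W) * Z V - exp m * S x) \<le> Z (V - {u. R x u})" if x: "x \<in> V" for x
    unfolding S_def
  proof (rule global_tradeoff[OF V rf])
    fix U assume U: "U \<subseteq> V \<inter> {u. R x u}"
    have "finite U" using U V finite_subset by auto
    show "(\<Sum>u\<in>U. ?a u * sum ?a (U \<inter> {v. R u v})) \<le> m * sum ?a U"
      unfolding m_def
    proof (rule ordered_sparse[OF \<open>finite U\<close>, where h = "h x"])
      fix u assume u: "u \<in> U"
      have "sum w {v \<in> U. R u v \<and> h x u \<le> h x v} \<le>
          sum w {v \<in> V. R x v \<and> R u v \<and> h x u \<le> h x v}"
        using U V w(1) by (intro sum_mono2) auto
      also have "\<dots> \<le> Q" using u U x by (intro Q) auto
      finally show "sum ?a {v \<in> U. R u v \<and> h x u \<le> h x v} \<le> l * Q"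
        using l by (simp add: sum_distrib_left[symmetric])
    qed
  qed
  \<comment> \<open>Double counting: a point \<open>u\<close> of the random set is counted with weight \<open>w {x. R u x} \<le> D\<close>.\<close>
  have total: "(\<Sum>x\<in>V. w x * S x) \<le> D * Z1 V"
  proof -
    have "(\<Sum>x\<in>V. w x * S x) =
        (\<Sum>x\<in>V. \<Sum>I\<in>stable_sets R V. (w x * real (card (I \<inter> {u. R x u}))) * prod ?a I)"
      by (simp add: S_def sum_distrib_left mult.assoc)
    also have "\<dots> = (\<Sum>I\<in>stable_sets R V. (\<Sum>x\<in>V. w x * real (card (I \<inter> {u. R x u}))) * prod ?a I)"
      by (subst sum.swap) (simp add: sum_distrib_right)
    also have "\<dots> \<le> (\<Sum>I\<in>stable_sets R V. (real (card I) * D) * prod ?a I)"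
    proof (intro sum_mono mult_right_mono prod_a_nonneg)
      fix I assume I: "I \<in> stable_sets R V"
      then have I': "I \<subseteq> V" "finite I" using V finite_subset by (auto simp: stable_sets_def)
      have "(\<Sum>x\<in>V. w x * real (card (I \<inter> {u. R x u}))) =
          (\<Sum>x\<in>V. \<Sum>u\<in>I. if R x u then w x else 0)"
        using I' by (simp add: sum.If_cases mult.commute)
      also have "\<dots> = (\<Sum>u\<in>I. \<Sum>x\<in>V. if R x u then w x else 0)" by (rule sum.swap)
      also have "\<dots> = (\<Sum>u\<in>I. sum w {x \<in> V. R u x})"
        by (simp add: sum.inter_filter[OF V, symmetric] nbr)
      also have "\<dots> \<le> (\<Sum>u\<in>I. D)" using I' D by (intro sum_mono) auto
      finally show "(\<Sum>x\<in>V. w x * real (card (I \<inter> {u. R x u}))) \<le> real (card I) * D" by simp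
    qed
    also have "\<dots> = D * Z1 V" by (simp add: Z1_def sum_distrib_left mult_ac)
    finally show ?thesis .
  qed
  have "b * ((1 + W) * Z V - exp m * (D * Z1 V))
      \<le> b * ((1 + W) * Z V - exp m * (\<Sum>x\<in>V. w x * S x))"
    using b total by (intro mult_left_mono) auto
  also have "\<dots> = b * (\<Sum>x\<in>V. w x * ((1 + W) * Z V - exp m * S x))"
    using w(2) by (simp add: right_diff_distrib sum_subtractf sum_distrib_right[symmetric]
        sum_distrib_left mult_ac)
  also have "\<dots> = (\<Sum>x\<in>V. ?a x * (exp (- W) * ((1 + W) * Z V - exp m * S x)))"
    by (simp add: b_def sum_distrib_left mult_ac)
  also have "\<dots> \<le> (\<Sum>x\<in>V. ?a x * Z (V - {u. R x u}))"
    by (intro sum_mono mult_left_mono step a_nonneg)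
  also have "\<dots> = Z1 V" using Z1_eq[OF V rf] by simp
  finally have main: "b * (1 + W) * Z V \<le> (1 + b * exp m * D) * Z1 V" by (simp add: algebra_simps)
  \<comment> \<open>Some stable set is at least as large as the average one.\<close>
  define k where "k = Max (card ` stable_sets R V)"
  have fin: "finite (card ` stable_sets R V)" using finite_stable_sets[OF V] by simp
  have "k \<in> card ` stable_sets R V"
    unfolding k_def using fin empty_stable by (intro Max_in) blast+
  then obtain I where I: "I \<in> stable_sets R V" "k = card I" by auto
  have "Z1 V \<le> real k * Z V"
    unfolding Z1_def Z_def sum_distrib_left
    using fin by (intro sum_mono mult_right_mono prod_a_nonneg) (auto simp: k_def)
  then have "b * (1 + W) * Z V \<le> (1 + b * exp m * D) * (real k * Z V)"
    using main b D0 by (intro order_trans[OF main] mult_left_mono) auto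
  then have "b * (1 + W) * Z V \<le> real k * (1 + b * exp m * D) * Z V" by (simp only: mult_ac)
  then have "b * (1 + W) \<le> real k * (1 + b * exp m * D)" using Zpos by simp
  then show thesis using that[OF I(1)] I(2) by (simp add: b_def m_def)
qed

section \<open>Rotation invariance of the cap area\<close>

abbreviation leb :: "nat \<Rightarrow> (nat \<Rightarrow> real) measure" where
  "leb d \<equiv> PiM {..<d} (\<lambda>_. lborel)"

lemma space_leb: "space (leb d) = euclid d"
  by (simp add: space_PiM euclid_def)

lemma ip_nonneg: "0 \<le> ip d f f"
  by (auto simp: ip_def intro!: sum_nonneg)

lemma ip_commute: "ip d x y = ip d y x"
  by (simp add: ip_def mult.commute)

lemma ip_eq_0:
  assumes "ip d f f = 0"
  shows "ip d x f = 0"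
proof -
  have "f i = 0" if "i < d" for i
    using assms that unfolding ip_def by (subst (asm) sum_nonneg_eq_0_iff) auto
  then show ?thesis by (simp add: ip_def)
qed

lemma ip_unit: "x \<in> unit_sphere d \<Longrightarrow> ip d x x = 1"
  by (simp add: unit_sphere_def)

lemma abs_ip_le: "\<bar>ip d x y\<bar> \<le> sqrt (ip d x x) * sqrt (ip d y y)"
proof -
  have "(ip d x y)\<^sup>2 \<le> ip d x x * ip d y y"
    using Cauchy_Schwarz_ineq_sum[of x y "{..<d}"] by (simp add: ip_def power2_eq_square)
  then have "\<bar>ip d x y\<bar> \<le> sqrt (ip d x x * ip d y y)"
    using real_sqrt_le_mono by fastforce
  then show ?thesis by (simp add: real_sqrt_mult)
qed

lemma borel_measurable_coord:
  "i < d \<Longrightarrow> (\<lambda>f. f i) \<in> borel_measurable (leb d)"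
  using measurable_component_singleton[of i "{..<d}" "\<lambda>_. lborel :: real measure"] by simp

lemma borel_measurable_ip: "(\<lambda>f. ip d x f) \<in> borel_measurable (leb d)"
  unfolding ip_def by (intro borel_measurable_sum borel_measurable_times) auto

lemma borel_measurable_ip_self: "(\<lambda>f. ip d f f) \<in> borel_measurable (leb d)"
  unfolding ip_def by (intro borel_measurable_sum borel_measurable_times) auto

text \<open>
  Rotation invariance of Lebesgue measure is obtained from its translation invariance in a single
  coordinate: a shear translates each line parallel to an axis, and a rotation in a coordinate plane
  is a product of three shears.
\<close>

definition shear :: "nat \<Rightarrow> nat \<Rightarrow> real \<Rightarrow> (nat \<Rightarrow> real) \<Rightarrow> (nat \<Rightarrow> real)" where
  "shear i j a f = f(i := f i + a * f j)"

lemma shear_measurable: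
  assumes "i < d" "j < d"
  shows "shear i j a \<in> measurable (leb d) (leb d)"
proof -
  have "(\<lambda>f. if k = i then f i + a * f j else f k) \<in> borel_measurable (leb d)" if "k < d" for k
    using assms that by simp
  moreover have "shear i j a f \<in> extensional {..<d}" if "f \<in> space (leb d)" for f
    using that assms by (auto simp: shear_def space_PiM PiE_def extensional_def)
  ultimately show ?thesis
    by (intro measurable_PiM_single') (auto simp: shear_def space_PiM PiE_def fun_upd_def)
qed

lemma emeasure_shear:
  assumes ij: "i < d" "j < d" "i \<noteq> j" and A: "A \<in> sets (leb d)"
  shows "emeasure (leb d) (shear i j a -` A \<inter> space (leb d)) = emeasure (leb d) A"
proof -
  interpret product_sigma_finite "\<lambda>_::nat. lborel :: real measure" by standard
  define I where "I = {..<d} - {i}"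
  have I: "finite I" "i \<notin> I" "insert i I = {..<d}" using ij by (auto simp: I_def)
  note [measurable] = A
  \<comment> \<open>Fubini, with the coordinate \<open>i\<close> that the shear moves as the inner variable.\<close>
  have fub: "emeasure (leb d) B = (\<integral>\<^sup>+ x. \<integral>\<^sup>+ y. indicator B (x(i := y)) \<partial>lborel \<partial>PiM I (\<lambda>_. lborel))"
    if "B \<in> sets (leb d)" for B
    using product_nn_integral_insert[OF I(1,2), of "indicator B"] that unfolding I(3) by simp
  have "emeasure (leb d) (shear i j a -` A \<inter> space (leb d)) =
    (\<integral>\<^sup>+ x. \<integral>\<^sup>+ y. indicator A (x(i := x j * a + 1 * y)) \<partial>lborel \<partial>PiM I (\<lambda>_. lborel))"
    unfolding fub[OF measurable_sets[OF shear_measurable[OF ij(1,2)] A]]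
  proof (intro nn_integral_cong)
    fix x :: "nat \<Rightarrow> real" and y :: real
    assume x: "x \<in> space (PiM I (\<lambda>_. lborel :: real measure))"
    then have "x(i := y) \<in> space (leb d)"
      by (auto simp: space_PiM PiE_def extensional_def I(3)[symmetric])
    moreover have "shear i j a (x(i := y)) = x(i := x j * a + 1 * y)"
      using ij by (simp add: shear_def add.commute mult.commute)
    ultimately show "indicator (shear i j a -` A \<inter> space (leb d)) (x(i := y)) =
        (indicator A (x(i := x j * a + 1 * y)) :: ennreal)"
      by (simp add: indicator_def)
  qed
  also have "\<dots> = (\<integral>\<^sup>+ x. \<integral>\<^sup>+ y. indicator A (x(i := y)) \<partial>lborel \<partial>PiM I (\<lambda>_. lborel))"
  proof (rule nn_integral_cong)
    fix x assume x: "x \<in> space (PiM I (\<lambda>_. lborel :: real measure))"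
    have "(\<lambda>y. x(i := y)) \<in> measurable lborel (PiM (insert i I) (\<lambda>_. lborel :: real measure))"
      using x by (intro measurable_component_update I) 
    then have "(\<lambda>y. x(i := y)) \<in> measurable borel (leb d)" unfolding I(3) by simp
    then have "(\<lambda>y. indicator A (x(i := y)) :: ennreal) \<in> borel_measurable borel" by measurable
    from nn_integral_real_affine[OF this, of 1 "x j * a"]
    show "(\<integral>\<^sup>+ y. indicator A (x(i := x j * a + 1 * y)) \<partial>lborel) =
        (\<integral>\<^sup>+ y. indicator A (x(i := y)) \<partial>lborel)" by simp
  qed
  also have "\<dots> = emeasure (leb d) A" by (rule fub[OF A, symmetric])
  finally show ?thesis .
qed

definition plane_rotation :: "nat \<Rightarrow> nat \<Rightarrow> real \<Rightarrow> real \<Rightarrow> (nat \<Rightarrow> real) \<Rightarrow> (nat \<Rightarrow> real)" where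
  "plane_rotation i j c s f = f(i := c * f i - s * f j, j := s * f i + c * f j)"

text \<open>
  This is the matrix identity
  \<open>(c, -s; s, c) = (1, b; 0, 1) (1, 0; s, 1) (1, b; 0, 1)\<close> with \<open>b = (c - 1) / s\<close>; the shear
  parameter \<open>b\<close> is the reason for excluding \<open>s = 0\<close>.
\<close>

lemma plane_rotation_shears:
  assumes "i \<noteq> j" "c\<^sup>2 + s\<^sup>2 = 1" "s \<noteq> 0"
  shows "plane_rotation i j c s f =
    shear i j ((c - 1) / s) (shear j i s (shear i j ((c - 1) / s) f))"
proof
  fix k
  define b where "b = (c - 1) / s"
  have bs: "b * s = c - 1" using assms by (simp add: b_def)
  have "b * (c + 1) * s = (b * s) * (c + 1)" by simp
  also have "\<dots> = - s * s"
    unfolding bs using assms(2) by (simp add: power2_eq_square algebra_simps)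
  finally have "b * (c + 1) * s = - s * s" .
  then have bc: "b * (c + 1) = - s" using mult_right_cancel[OF assms(3), of "b * (c + 1)" "- s"] by simp
  have "s * (f i + b * f j) + f j = s * f i + (b * s + 1) * f j"
    by (simp add: algebra_simps)
  then have e2: "s * (f i + b * f j) + f j = s * f i + c * f j"
    unfolding bs by simp
  have "f i + b * f j + b * (f j + s * (f i + b * f j)) =
     f i * (1 + b * s) + f j * (b * (1 + (1 + b * s)))"
    by (simp add: algebra_simps)
  also have "b * (1 + (1 + b * s)) = - s" unfolding bs using bc by (simp add: add.commute)
  also have "f i * (1 + b * s) + f j * - s = c * f i - s * f j" unfolding bs by simp
  finally show "plane_rotation i j c s f k =
    shear i j ((c - 1) / s) (shear j i s (shear i j ((c - 1) / s) f)) k"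
    using assms(1) e2 by (simp add: plane_rotation_def shear_def b_def add.commute)
qed

lemma emeasure_plane_rotation:
  assumes ij: "i < d" "j < d" "i \<noteq> j" and cs: "c\<^sup>2 + s\<^sup>2 = 1" "s \<noteq> 0" and A: "A \<in> sets (leb d)"
  shows "emeasure (leb d) (plane_rotation i j c s -` A \<inter> space (leb d)) = emeasure (leb d) A"
proof -
  let ?b = "(c - 1) / s" and ?sp = "space (leb d)"
  have m: "shear i j ?b -` B \<inter> ?sp \<in> sets (leb d)" "shear j i s -` B \<inter> ?sp \<in> sets (leb d)"
    if "B \<in> sets (leb d)" for B
    using measurable_sets[OF shear_measurable that] ij by auto
  have sp: "shear i j ?b f \<in> ?sp" "shear j i s f \<in> ?sp" if "f \<in> ?sp" for f
    using measurable_space[OF shear_measurable that] ij by auto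
  have "plane_rotation i j c s -` A \<inter> ?sp =
      shear i j ?b -` (shear j i s -` (shear i j ?b -` A \<inter> ?sp) \<inter> ?sp) \<inter> ?sp"
    using sp by (auto simp: plane_rotation_shears[OF ij(3) cs])
  then have "emeasure (leb d) (plane_rotation i j c s -` A \<inter> ?sp) =
      emeasure (leb d) (shear j i s -` (shear i j ?b -` A \<inter> ?sp) \<inter> ?sp)"
    using emeasure_shear[OF ij m(2)[OF m(1)[OF A]]] by (simp only:)
  also have "\<dots> = emeasure (leb d) (shear i j ?b -` A \<inter> ?sp)"
    by (rule emeasure_shear[OF ij(2,1) ij(3)[symmetric] m(1)[OF A]])
  also have "\<dots> = emeasure (leb d) A" by (rule emeasure_shear[OF ij A])
  finally show ?thesis .
qed

lemma ip_plane_rotation: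
  assumes ij: "i < d" "j < d" "i \<noteq> j" and cs: "c\<^sup>2 + s\<^sup>2 = 1"
  shows "ip d (plane_rotation i j c s x) (plane_rotation i j c s y) = ip d x y"
proof -
  have split: "ip d u v = u i * v i + (u j * v j + (\<Sum>k\<in>{..<d} - {i} - {j}. u k * v k))" for u v
    unfolding ip_def using ij by (simp add: sum.remove[of "{..<d}" i] sum.remove[of "{..<d} - {i}" j])
  have "(\<Sum>k\<in>{..<d} - {i} - {j}. plane_rotation i j c s x k * plane_rotation i j c s y k) =
      (\<Sum>k\<in>{..<d} - {i} - {j}. x k * y k)"
    by (intro sum.cong) (auto simp: plane_rotation_def)
  moreover have "(c * x i - s * x j) * (c * y i - s * y j) + (s * x i + c * x j) * (s * y i + c * y j)
      = (c\<^sup>2 + s\<^sup>2) * (x i * y i + x j * y j)"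
    by (simp add: algebra_simps power2_eq_square)
  ultimately show ?thesis unfolding split using ij cs by (simp add: plane_rotation_def)
qed

lemma plane_rotation_in_euclid:
  "i < d \<Longrightarrow> j < d \<Longrightarrow> x \<in> euclid d \<Longrightarrow> plane_rotation i j c s x \<in> euclid d"
  by (auto simp: euclid_def plane_rotation_def PiE_def extensional_def)

text \<open>
  The cone over the cap \<open>{y. t \<le> ip d x y}\<close> of the sphere, written with homogeneous inequalities so
  that no normalisation is involved.
\<close>

definition cap_cone :: "nat \<Rightarrow> real \<Rightarrow> (nat \<Rightarrow> real) \<Rightarrow> (nat \<Rightarrow> real) set" where
  "cap_cone d t x = {f \<in> euclid d. ip d f f \<le> 1 \<and> t * sqrt (ip d f f) \<le> ip d x f}"

lemma cap_cone_sets: "cap_cone d t x \<in> sets (leb d)"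
proof -
  have "{f \<in> space (leb d). ip d f f \<le> 1} \<in> sets (leb d)"
    by (rule borel_measurable_le[OF borel_measurable_ip_self borel_measurable_const])
  moreover have "{f \<in> space (leb d). t * sqrt (ip d f f) \<le> ip d x f} \<in> sets (leb d)"
    by (intro borel_measurable_le borel_measurable_times borel_measurable_const borel_measurable_ip
        measurable_compose[OF borel_measurable_ip_self borel_measurable_sqrt])
  ultimately have "{f \<in> space (leb d). ip d f f \<le> 1} \<inter>
      {f \<in> space (leb d). t * sqrt (ip d f f) \<le> ip d x f} \<in> sets (leb d)"
    by (rule sets.Int)
  moreover have "{f \<in> space (leb d). ip d f f \<le> 1} \<inter>
      {f \<in> space (leb d). t * sqrt (ip d f f) \<le> ip d x f} = cap_cone d t x"
    by (auto simp: cap_cone_def space_leb)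
  ultimately show ?thesis by simp
qed

lemma emeasure_cap_cone_rotate:
  assumes ij: "i < d" "j < d" "i \<noteq> j" and cs: "c\<^sup>2 + s\<^sup>2 = 1" "s \<noteq> 0"
  shows "emeasure (leb d) (cap_cone d t (plane_rotation i j c s x)) = emeasure (leb d) (cap_cone d t x)"
proof -
  have "plane_rotation i j c s -` cap_cone d t (plane_rotation i j c s x) \<inter> space (leb d) = cap_cone d t x"
    using ij by (auto simp: cap_cone_def space_leb ip_plane_rotation[OF ij cs(1)]
        plane_rotation_in_euclid)
  then show ?thesis
    using emeasure_plane_rotation[OF ij cs cap_cone_sets, of t "plane_rotation i j c s x"] by simp
qed

text \<open>
  Rotations in the planes spanned by the coordinates \<open>0\<close> and \<open>i\<close> clear the coordinates of the centre
  one after the other, and leave a positive coordinate \<open>0\<close>; the induction is on the number of nonzero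
  coordinates that are still to be cleared. A centre that has none, which may be the antipode of the
  pole, is first moved by a quarter turn.
\<close>

lemma emeasure_cap_cone_pole:
  assumes d: "2 \<le> d" and x: "x \<in> unit_sphere d"
  shows "emeasure (leb d) (cap_cone d t x) = emeasure (leb d) (cap_cone d t (pole d))"
proof -
  have step: "emeasure (leb d) (cap_cone d t x) = emeasure (leb d) (cap_cone d t (pole d))"
    if "n = card {i \<in> {1..<d}. x i \<noteq> 0}" "n > 0" "x \<in> unit_sphere d" for n x
    using that
  proof (induction n arbitrary: x rule: less_induct)
    case (less n)
    then have "{i \<in> {1..<d}. x i \<noteq> 0} \<noteq> {}" by (metis card.empty less_irrefl)
    then obtain i where i: "1 \<le> i" "i < d" "x i \<noteq> 0" by auto
    define r where "r = sqrt ((x 0)\<^sup>2 + (x i)\<^sup>2)"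
    have r2: "r\<^sup>2 = (x 0)\<^sup>2 + (x i)\<^sup>2" by (simp add: r_def)
    have "(x 0)\<^sup>2 + (x i)\<^sup>2 > 0" using i by (simp add: add_nonneg_pos)
    then have r: "r > 0" by (simp add: r_def)
    \<comment> \<open>The rotation that sends the coordinates \<open>(x 0, x i)\<close> to \<open>(r, 0)\<close>.\<close>
    define c s where "c = x 0 / r" and "s = - x i / r"
    have cs: "c\<^sup>2 + s\<^sup>2 = 1" "s \<noteq> 0"
      using r r2 i by (auto simp: c_def s_def power_divide add_divide_distrib[symmetric])
    define y where "y = plane_rotation 0 i c s x"
    have "c * x 0 - s * x i = r\<^sup>2 / r"
      unfolding r2 by (simp add: c_def s_def power2_eq_square add_divide_distrib)
    then have y: "y 0 = r" "y i = 0" "\<And>k. k \<noteq> 0 \<Longrightarrow> k \<noteq> i \<Longrightarrow> y k = x k"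
      using r i by (auto simp: y_def plane_rotation_def c_def s_def power2_eq_square)
    have ys: "y \<in> unit_sphere d"
      using less.prems(3) i cs plane_rotation_in_euclid[of 0 d i x c s]
      by (auto simp: unit_sphere_def y_def ip_plane_rotation)
    have eq: "emeasure (leb d) (cap_cone d t y) = emeasure (leb d) (cap_cone d t x)"
      unfolding y_def using i cs d by (intro emeasure_cap_cone_rotate) auto
    define m where "m = card {i \<in> {1..<d}. y i \<noteq> 0}"
    have "m < n" unfolding m_def less.prems(1)
    proof (rule psubset_card_mono)
      show "{i \<in> {1..<d}. y i \<noteq> 0} \<subset> {i \<in> {1..<d}. x i \<noteq> 0}"
      proof
        have "x k \<noteq> 0" if "k \<in> {1..<d}" "y k \<noteq> 0" for k
          using that y(2) y(3)[of k] by (cases "k = i") auto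
        then show "{i \<in> {1..<d}. y i \<noteq> 0} \<subseteq> {i \<in> {1..<d}. x i \<noteq> 0}" by blast
        have "i \<in> {i \<in> {1..<d}. x i \<noteq> 0} - {i \<in> {1..<d}. y i \<noteq> 0}" using i y(2) by simp
        then show "{i \<in> {1..<d}. y i \<noteq> 0} \<noteq> {i \<in> {1..<d}. x i \<noteq> 0}" by blast
      qed
    qed simp
    show ?case
    proof (cases "m > 0")
      case True
      then show ?thesis using less.IH[OF \<open>m < n\<close> m_def True ys] eq by simp
    next
      case False
      then have "{i \<in> {1..<d}. y i \<noteq> 0} = {}" by (simp add: m_def)
      then have z: "y k = 0" if "k < d" "k \<noteq> 0" for k using that by (auto simp: Suc_le_eq)
      have "ip d y y = y 0 * y 0"
        unfolding ip_def using d z by (subst sum.remove[of _ 0]) auto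
      then have "r\<^sup>2 = 1" using ys y(1) by (simp add: unit_sphere_def power2_eq_square)
      then have "r = 1" using r by (simp add: power2_eq_1_iff)
      then have "y = pole d" using ys z y(1)
        by (auto simp: fun_eq_iff pole_def unit_sphere_def euclid_def PiE_def extensional_def)
      then show ?thesis using eq by simp
    qed
  qed
  show ?thesis
  proof (cases "card {i \<in> {1..<d}. x i \<noteq> 0} > 0")
    case True
    then show ?thesis using step x by blast
  next
    case False
    then have "{i \<in> {1..<d}. x i \<noteq> 0} = {}" by simp
    then have z: "x k = 0" if "k < d" "k \<noteq> 0" for k using that by (auto simp: Suc_le_eq)
    have "ip d x x = x 0 * x 0"
      unfolding ip_def using d z by (subst sum.remove[of _ 0]) auto
    then have x0: "x 0 \<noteq> 0" using x by (auto simp: unit_sphere_def)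
    define y where "y = plane_rotation 0 1 0 1 x"
    have y1: "y 1 \<noteq> 0" using x0 by (simp add: y_def plane_rotation_def)
    have ys: "y \<in> unit_sphere d"
      using x d plane_rotation_in_euclid[of 0 d 1 x 0 1]
      by (auto simp: unit_sphere_def y_def ip_plane_rotation)
    have "{i \<in> {1..<d}. y i \<noteq> 0} \<noteq> {}" using y1 d by (auto intro!: exI[of _ 1])
    then have "card {i \<in> {1..<d}. y i \<noteq> 0} > 0" by (simp add: card_gt_0_iff)
    from step[OF refl this ys] show ?thesis
      using emeasure_cap_cone_rotate[of 0 d 1 0 1 t x] d by (simp add: y_def)
  qed
qed

lemma cone_over_cap:
  assumes d: "1 \<le> d" and x: "x \<in> unit_sphere d"
  shows "cone_over d (spherical_cap d \<theta> x) = cap_cone d (cos \<theta>) x"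
proof (subst cone_over_subset_sphere, goal_cases)
  case 1 show ?case by (auto simp: spherical_cap_def)
next
  case 2
  have "x \<in> spherical_cap d \<theta> x" using x by (simp add: spherical_cap_def unit_sphere_def)
  then show ?case by blast
next
  case 3
  show ?case
  proof (intro set_eqI)
    fix f
    have eq: "ip d x (\<lambda>i\<in>{..<d}. f i / sqrt (ip d f f)) = ip d x f / sqrt (ip d f f)"
      unfolding ip_def[of d x] by (simp add: sum_divide_distrib)
    show "f \<in> {f \<in> euclid d. sqrt (ip d f f) \<le> 1 \<and> (sqrt (ip d f f) \<noteq> 0 \<longrightarrow>
          (\<lambda>i\<in>{..<d}. f i / sqrt (ip d f f)) \<in> spherical_cap d \<theta> x)} \<longleftrightarrow> f \<in> cap_cone d (cos \<theta>) x"
    proof (cases "ip d f f = 0")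
      case True
      then show ?thesis by (simp add: cap_cone_def ip_eq_0)
    next
      case False
      then have "0 < sqrt (ip d f f)" using ip_nonneg[of d f] by simp
      then show ?thesis using eq normalize_in_sphere[of d f]
        by (auto simp: cap_cone_def spherical_cap_def pos_le_divide_eq)
    qed
  qed
qed

lemma measure_cap_cone:
  assumes d: "2 \<le> d" and x: "x \<in> unit_sphere d"
  shows "measure (leb d) (cap_cone d (cos \<phi>) x) = cap_area d \<phi> * unit_ball_vol (real d)"
proof -
  have vol: "unit_ball_vol (real d) \<noteq> 0" using unit_ball_vol_pos[of "real d"] by linarith
  have "measure (leb d) (cap_cone d (cos \<phi>) x) = measure (leb d) (cap_cone d (cos \<phi>) (pole d))"
    using emeasure_cap_cone_pole[OF assms] by (simp add: measure_def)
  also have "\<dots> = cap_area d \<phi> * unit_ball_vol (real d)"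
    using d vol by (simp add: cap_area_def sphere_area_def cone_over_cap pole_in_sphere
        measure_cone_over_sphere)
  finally show ?thesis .
qed

section \<open>Discretising the sphere\<close>

text \<open>
  The label of the cube of side \<open>1 / N\<close> that contains \<open>x\<close>.
\<close>

definition grid_cell :: "nat \<Rightarrow> nat \<Rightarrow> (nat \<Rightarrow> real) \<Rightarrow> nat \<Rightarrow> int" where
  "grid_cell d N x = (\<lambda>i\<in>{..<d}. \<lfloor>real N * x i\<rfloor>)"

text \<open>
  The radial projection to the sphere. The origin, which has no direction, is sent to the pole, so
  that every point of the ball has a direction.
\<close>

definition direction :: "nat \<Rightarrow> (nat \<Rightarrow> real) \<Rightarrow> nat \<Rightarrow> real" where
  "direction d f = (if ip d f f = 0 then pole d else (\<lambda>i\<in>{..<d}. f i / sqrt (ip d f f)))"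

definition unit_ball :: "nat \<Rightarrow> (nat \<Rightarrow> real) set" where
  "unit_ball d = {f \<in> euclid d. ip d f f \<le> 1}"

lemma direction_in_sphere: "1 \<le> d \<Longrightarrow> direction d f \<in> unit_sphere d"
  using normalize_in_sphere[of d f] by (simp add: direction_def pole_in_sphere)

lemma ip_direction:
  "sqrt (ip d f f) * ip d x (direction d f) = ip d x f"
proof (cases "ip d f f = 0")
  case True
  then show ?thesis by (simp add: ip_eq_0)
next
  case False
  then have "sqrt (ip d f f) \<noteq> 0" by simp
  moreover have "ip d x (direction d f) = ip d x f / sqrt (ip d f f)"
    using False unfolding ip_def[of d x] by (simp add: direction_def sum_divide_distrib)
  ultimately show ?thesis by simp
qed

lemma unit_ball_measure:
  assumes "1 \<le> d"
  shows "measure (leb d) (unit_ball d) = unit_ball_vol (real d)"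
proof -
  have "unit_sphere d \<noteq> {}" using pole_in_sphere[OF assms] by blast
  then have "cone_over d (unit_sphere d) = unit_ball d"
    using normalize_in_sphere by (subst cone_over_subset_sphere) (auto simp: unit_ball_def)
  then show ?thesis using measure_cone_over_sphere[OF assms] by simp
qed

lemma unit_ball_sets: "unit_ball d \<in> sets (leb d)"
proof -
  have "unit_ball d = {f \<in> space (leb d). ip d f f \<le> 1}" by (simp add: unit_ball_def space_leb)
  then show ?thesis
    using borel_measurable_le[OF borel_measurable_ip_self borel_measurable_const, of d 1] by simp
qed

lemma unit_ball_fmeasurable: "1 \<le> d \<Longrightarrow> unit_ball d \<in> fmeasurable (leb d)"
proof (rule fmeasurableI[OF unit_ball_sets])
  assume d: "1 \<le> d"
  have "measure (leb d) (unit_ball d) \<noteq> 0"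
    using unit_ball_measure[OF d] unit_ball_vol_pos[of "real d"] by linarith
  then show "emeasure (leb d) (unit_ball d) < \<infinity>"
    by (metis infinity_ennreal_def less_top measure_zero_top)
qed

lemma borel_measurable_direction:
  assumes "i < d"
  shows "(\<lambda>f. direction d f i) \<in> borel_measurable (leb d)"
proof -
  have "{f \<in> space (leb d). ip d f f = 0} \<in> sets (leb d)"
    by (rule borel_measurable_eq[OF borel_measurable_ip_self borel_measurable_const])
  moreover have "(\<lambda>f. f i / sqrt (ip d f f)) \<in> borel_measurable (leb d)"
    by (intro borel_measurable_divide borel_measurable_coord assms
        measurable_compose[OF borel_measurable_ip_self borel_measurable_sqrt])
  ultimately have "(\<lambda>f. if ip d f f = 0 then pole d i else f i / sqrt (ip d f f)) \<in> borel_measurable (leb d)"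
    by (intro measurable_If) auto
  moreover have "(\<lambda>f. direction d f i) = (\<lambda>f. if ip d f f = 0 then pole d i else f i / sqrt (ip d f f))"
    using assms by (auto simp: direction_def)
  ultimately show ?thesis by simp
qed

lemma direction_cell_sets:
  assumes "b \<in> extensional {..<d}"
  shows "{f \<in> unit_ball d. grid_cell d N (direction d f) = b} \<in> sets (leb d)"
proof -
  have "{f \<in> space (leb d). \<forall>i\<in>{..<d}. of_int (b i) \<le> real N * direction d f i \<and>
      real N * direction d f i < of_int (b i) + 1} \<in> sets (leb d)"
    by (intro sets.sets_Collect_finite_All sets.sets_Collect_conj borel_measurable_le
        borel_measurable_less borel_measurable_times borel_measurable_const
        borel_measurable_direction) auto
  moreover have "{f \<in> unit_ball d. grid_cell d N (direction d f) = b} =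
      unit_ball d \<inter> {f \<in> space (leb d). \<forall>i\<in>{..<d}. of_int (b i) \<le> real N * direction d f i \<and>
      real N * direction d f i < of_int (b i) + 1}"
  proof -
    have "grid_cell d N y = b \<longleftrightarrow>
        (\<forall>i\<in>{..<d}. of_int (b i) \<le> real N * y i \<and> real N * y i < of_int (b i) + 1)" for y
    proof -
      have "grid_cell d N y = b \<longleftrightarrow> (\<forall>i\<in>{..<d}. \<lfloor>real N * y i\<rfloor> = b i)"
        using assms by (auto simp: grid_cell_def fun_eq_iff extensional_def restrict_def)
      then show ?thesis by (simp add: floor_eq_iff)
    qed
    then show ?thesis by (auto simp: space_leb unit_ball_def)
  qed
  ultimately show ?thesis by (simp only: sets.Int unit_ball_sets)
qed

lemma finite_cells: "finite (grid_cell d N ` unit_sphere d)"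
proof (rule finite_subset)
  show "grid_cell d N ` unit_sphere d \<subseteq> ({..<d} \<rightarrow>\<^sub>E {- int N..int N})"
  proof
    fix b assume "b \<in> grid_cell d N ` unit_sphere d"
    then obtain x where x: "x \<in> unit_sphere d" "b = grid_cell d N x" by auto
    have "\<lfloor>real N * x i\<rfloor> \<in> {- int N..int N}" if "i < d" for i
    proof -
      have "x i * x i \<le> ip d x x"
        unfolding ip_def using that by (intro member_le_sum) auto
      then have "(x i)\<^sup>2 \<le> 1" using x by (simp add: ip_unit power2_eq_square)
      then have "\<bar>x i\<bar> \<le> 1" by (simp add: abs_square_le_1)
      then have "\<bar>real N * x i\<bar> \<le> real N" by (simp add: abs_mult mult_left_le)
      then have "- real N \<le> real N * x i" "real N * x i \<le> real N" by linarith+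
      then show ?thesis by (simp add: le_floor_iff floor_le_iff)
    qed
    then show "b \<in> ({..<d} \<rightarrow>\<^sub>E {- int N..int N})" unfolding x(2) grid_cell_def by auto
  qed
qed (intro finite_PiE; simp)

lemma ip_same_cell:
  assumes m: "m \<in> unit_sphere d" and N: "0 < N"
    and cell: "grid_cell d N x = grid_cell d N y"
  shows "\<bar>ip d m x - ip d m y\<bar> \<le> sqrt (real d) / real N"
proof -
  have near: "(x i - y i) * (x i - y i) \<le> 1 / (real N)\<^sup>2" if "i < d" for i
  proof -
    have "\<lfloor>real N * x i\<rfloor> = \<lfloor>real N * y i\<rfloor>"
      using fun_cong[OF cell, of i] that by (simp add: grid_cell_def)
    then have "\<bar>real N * x i - real N * y i\<bar> \<le> 1" by linarith
    then have "(real N * x i - real N * y i)\<^sup>2 \<le> 1" by (simp add: abs_square_le_1)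
    then have "(real N)\<^sup>2 * (x i - y i)\<^sup>2 \<le> 1"
      by (simp add: power_mult_distrib[symmetric] right_diff_distrib)
    then show ?thesis using N by (simp add: field_simps power2_eq_square)
  qed
  define z where "z i = x i - y i" for i
  have "ip d z z \<le> real d * (1 / (real N)\<^sup>2)"
    unfolding ip_def z_def
    using sum_bounded_above[of "{..<d}" "\<lambda>i. (x i - y i) * (x i - y i)" "1 / (real N)\<^sup>2"] near
    by simp
  then have "sqrt (ip d z z) \<le> sqrt (real d) / real N"
    using real_sqrt_le_mono[of "ip d z z" "real d / (real N)\<^sup>2"] by (simp add: real_sqrt_divide)
  moreover have "ip d m z = ip d m x - ip d m y"
    by (simp add: ip_def z_def right_diff_distrib sum_subtractf)
  ultimately show ?thesis using abs_ip_le[of d m z] m by (simp add: ip_unit)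
qed

text \<open>
  A finite weighted set of points that imitates the sphere: the sphere is cut into pieces by a fine
  grid, each piece is represented by one of its points, and this point carries the area of the
  piece. The error \<open>\<eta>\<close> absorbs the distance of a point to its representative, uniformly over all caps.
\<close>

lemma discrete_sphere:
  assumes d: "2 \<le> d" and \<eta>: "0 < \<eta>"
  obtains V w where "finite V" "V \<subseteq> unit_sphere d" "\<And>v. 0 \<le> w v" "sum w V = 1"
    "\<And>m t \<phi>. m \<in> unit_sphere d \<Longrightarrow> cos \<phi> \<le> t - \<eta> \<Longrightarrow>
       sum w {v \<in> V. t \<le> ip d m v} \<le> cap_area d \<phi>"
proof -
  obtain N0 :: nat where N0: "sqrt (real d) / \<eta> < real N0" using reals_Archimedean2 by blast
  define N where "N = Suc N0"
  have N: "0 < N" by (simp add: N_def)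
  have "sqrt (real d) / \<eta> \<le> real N" using N0 by (simp add: N_def)
  then have N\<eta>: "sqrt (real d) / real N \<le> \<eta>" using N \<eta> by (simp add: field_simps)
  let ?c = "grid_cell d N"
  let ?vol = "unit_ball_vol (real d)"
  have vol: "0 < ?vol" using unit_ball_vol_pos[of "real d"] by linarith
  define p where "p b = (SOME x. x \<in> unit_sphere d \<and> ?c x = b)" for b
  define V where "V = p ` (?c ` unit_sphere d)"
  define cell where "cell v = {f \<in> unit_ball d. ?c (direction d f) = ?c v}" for v
  define w where "w v = measure (leb d) (cell v) / ?vol" for v
  have p: "p (?c x) \<in> unit_sphere d \<and> ?c (p (?c x)) = ?c x" if "x \<in> unit_sphere d" for x
    unfolding p_def using that by (intro someI_ex[of "\<lambda>y. y \<in> unit_sphere d \<and> ?c y = ?c x"]) blast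
  have finV: "finite V" unfolding V_def by (intro finite_imageI finite_cells)
  have Vs: "V \<subseteq> unit_sphere d" using p by (auto simp: V_def)
  have repr: "p (?c v) = v" if v: "v \<in> V" for v
  proof -
    obtain x where x: "x \<in> unit_sphere d" "v = p (?c x)" using v unfolding V_def by blast
    then show ?thesis using p[OF x(1)] by simp
  qed
  have inj: "u = v" if "u \<in> V" "v \<in> V" "?c u = ?c v" for u v
    using repr[OF that(1)] repr[OF that(2)] that(3) by metis
  have fm: "unit_ball d \<in> fmeasurable (leb d)" using d by (intro unit_ball_fmeasurable) simp
  have cs: "cell v \<in> sets (leb d)" for v
    unfolding cell_def by (rule direction_cell_sets) (simp add: grid_cell_def)
  have cf: "cell v \<in> fmeasurable (leb d)" for v
    by (rule fmeasurableI2[OF fm _ cs]) (auto simp: cell_def)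
  have sum_w: "sum w S = measure (leb d) (\<Union>v\<in>S. cell v) / ?vol" if "S \<subseteq> V" for S
  proof -
    have "measure (leb d) (\<Union>v\<in>S. cell v) = (\<Sum>v\<in>S. measure (leb d) (cell v))"
    proof (rule measure_UNION')
      show "finite S" using that finV finite_subset by blast
      show "cell v \<in> fmeasurable (leb d)" for v by (rule cf)
      show "pairwise (\<lambda>i j. disjnt (cell i) (cell j)) S"
      proof (intro pairwiseI)
        fix u v assume "u \<in> S" "v \<in> S" "u \<noteq> v"
        then have "?c u \<noteq> ?c v" using inj[of u v] that by blast
        then show "disjnt (cell u) (cell v)" by (auto simp: disjnt_def cell_def)
      qed
    qed
    then show ?thesis by (simp add: w_def sum_divide_distrib)
  qed
  have union_V: "(\<Union>v\<in>V. cell v) = unit_ball d"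
  proof
    show "unit_ball d \<subseteq> (\<Union>v\<in>V. cell v)"
    proof
      fix f assume f: "f \<in> unit_ball d"
      have ds: "direction d f \<in> unit_sphere d" using d by (intro direction_in_sphere) simp
      then have "p (?c (direction d f)) \<in> V" "f \<in> cell (p (?c (direction d f)))"
        using f p[OF ds] by (auto simp: V_def cell_def)
      then show "f \<in> (\<Union>v\<in>V. cell v)" by blast
    qed
  qed (auto simp: cell_def)
  show thesis
  proof (rule that[of V w])
    show "finite V" "V \<subseteq> unit_sphere d" by (fact finV Vs)+
    show "0 \<le> w v" for v using vol by (simp add: w_def)
    show "sum w V = 1" using sum_w[of V] vol d by (simp add: union_V unit_ball_measure)
  next
    fix m t \<phi> assume m: "m \<in> unit_sphere d" and t: "cos \<phi> \<le> t - \<eta>"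
    let ?S = "{v \<in> V. t \<le> ip d m v}"
    have "(\<Union>v\<in>?S. cell v) \<subseteq> cap_cone d (cos \<phi>) m"
    proof
      fix f assume "f \<in> (\<Union>v\<in>?S. cell v)"
      then obtain v where v: "v \<in> V" "t \<le> ip d m v" "f \<in> unit_ball d" "?c (direction d f) = ?c v"
        by (auto simp: cell_def)
      have "\<bar>ip d m (direction d f) - ip d m v\<bar> \<le> \<eta>"
        using ip_same_cell[OF m N v(4)] N\<eta> by linarith
      then have "cos \<phi> \<le> ip d m (direction d f)" using t v(2) by linarith
      then have "sqrt (ip d f f) * cos \<phi> \<le> sqrt (ip d f f) * ip d m (direction d f)"
        using ip_nonneg by (intro mult_left_mono) auto
      then show "f \<in> cap_cone d (cos \<phi>) m"
        using v(3) by (simp add: ip_direction cap_cone_def unit_ball_def mult.commute)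
    qed
    moreover have "cap_cone d (cos \<phi>) m \<in> fmeasurable (leb d)"
      by (rule fmeasurableI2[OF fm _ cap_cone_sets]) (auto simp: cap_cone_def unit_ball_def)
    moreover have "(\<Union>v\<in>?S. cell v) \<in> sets (leb d)"
      using finV cs by (intro sets.finite_UN) auto
    ultimately have "measure (leb d) (\<Union>v\<in>?S. cell v) \<le> measure (leb d) (cap_cone d (cos \<phi>) m)"
      using measure_mono_fmeasurable by blast
    also have "\<dots> = cap_area d \<phi> * ?vol" by (rule measure_cap_cone[OF d m])
    finally show "sum w ?S \<le> cap_area d \<phi>"
      using sum_w[of ?S] vol by (simp add: pos_divide_le_eq)
  qed
qed

section \<open>From graphs to spherical codes\<close>

text \<open>
  Two caps of angular radius \<open>arccos c\<close> around \<open>x\<close> and \<open>u\<close>, where \<open>u\<close> is in the cap of \<open>x\<close>: the part of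
  their intersection that is not farther from \<open>x\<close> than \<open>u\<close> lies in a cap centred at the spherical midpoint \<open>m\<close> of
  \<open>x\<close> and \<open>u\<close>, since \<open>ip d m v\<close> is proportional to \<open>ip d x v + ip d u v\<close>. With \<open>t = ip d x u\<close> its height is at least
  \<open>(c + t) / sqrt (2 + 2 * t)\<close>, which is increasing in \<open>t\<close>, so the worst case is \<open>t = c\<close>.
\<close>

lemma cap_intersection:
  assumes x: "x \<in> unit_sphere d" and u: "u \<in> unit_sphere d" and c: "0 \<le> c" "c \<le> ip d x u"
  obtains m where "m \<in> unit_sphere d"
    "\<And>v. c \<le> ip d u v \<Longrightarrow> ip d x u \<le> ip d x v \<Longrightarrow> 2 * c / sqrt (2 + 2 * c) \<le> ip d m v"
proof -
  define t where "t = ip d x u"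
  define r where "r = sqrt (2 + 2 * t)"
  have r: "0 < r" "r\<^sup>2 = 2 + 2 * t" using c by (auto simp: r_def t_def)
  define m where "m = (\<lambda>i\<in>{..<d}. (x i + u i) / r)"
  have ipm: "ip d m v = (ip d x v + ip d u v) / r" for v
    by (simp add: ip_def m_def add_divide_distrib distrib_right sum.distrib sum_divide_distrib)
  have "ip d m m = (ip d m x + ip d m u) / r"
    using ipm[of m] by (simp add: ip_commute)
  also have "\<dots> = (2 + 2 * t) / r\<^sup>2"
    using x u by (simp add: ipm ip_unit t_def ip_commute[of d u x] power2_eq_square
        add_divide_distrib)
  also have "\<dots> = 1" unfolding r(2)[symmetric] using r(1) by simp
  finally have ms: "m \<in> unit_sphere d" by (simp add: unit_sphere_def euclid_def m_def)
  have "2 * c / sqrt (2 + 2 * c) \<le> (c + t) / r"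
  proof (rule power2_le_imp_le)
    have ct: "0 \<le> t - c" using c by (simp add: t_def)
    \<comment> \<open>After squaring, the difference of the two sides is expanded in powers of \<open>t - c\<close>.\<close>
    have "(c + t)\<^sup>2 * (2 + 2 * c) - (2 * c)\<^sup>2 * (2 + 2 * t) =
        8 * c * (t - c) + 2 * (1 + c) * (t - c)\<^sup>2"
      by (simp add: power2_eq_square algebra_simps)
    also have "\<dots> \<ge> 0" using c ct by simp
    finally have "(2 * c)\<^sup>2 * (2 + 2 * t) \<le> (c + t)\<^sup>2 * (2 + 2 * c)" by simp
    then have "(2 * c)\<^sup>2 \<le> (c + t)\<^sup>2 * (2 + 2 * c) / (2 + 2 * t)"
      using c ct by (subst pos_le_divide_eq) auto
    then have "(2 * c)\<^sup>2 / (2 + 2 * c) \<le> (c + t)\<^sup>2 / (2 + 2 * t)"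
      using c by (subst pos_divide_le_eq) auto
    then show "(2 * c / sqrt (2 + 2 * c))\<^sup>2 \<le> ((c + t) / r)\<^sup>2"
      using c by (simp add: power_divide r(2))
    show "0 \<le> (c + t) / r" using c ct r by simp
  qed
  then show thesis
  proof (intro that[OF ms])
    fix v assume "2 * c / sqrt (2 + 2 * c) \<le> (c + t) / r" "c \<le> ip d u v" "ip d x u \<le> ip d x v"
    moreover from this have "(c + t) / r \<le> ip d m v"
      unfolding ipm using r by (intro divide_right_mono) (auto simp: t_def)
    ultimately show "2 * c / sqrt (2 + 2 * c) \<le> ip d m v" by linarith
  qed
qed

lemma card_le_max_code_size:
  assumes "0 < \<theta>" "\<theta> \<le> pi" "spherical_code d \<theta> X"
  shows "card X \<le> max_code_size d \<theta>"
  unfolding max_code_size_def using finite_code_sizes[OF assms(1,2)] assms(3)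
  by (intro Max_ge) auto

text \<open>
  The graph on the discretised sphere whose edges are the pairs at angle less than \<open>\<theta>\<close>: its stable
  sets are spherical codes, its neighbourhoods are caps of radius \<open>\<theta>\<close>, and when the vertices are ordered
  from far to near \<open>x\<close>, the common neighbours of \<open>x\<close> and \<open>u\<close> that come after \<open>u\<close> lie in a cap of radius \<open>q\<close>. The slack in \<open>\<phi>\<close> and
  \<open>\<psi>\<close> pays for the discretisation.
\<close>

lemma code_size_bound_approx:
  assumes d: "2 \<le> d" and \<theta>: "0 < \<theta>" "\<theta> < pi / 2"
    and q: "cos q = 2 * cos \<theta> / sqrt (2 + 2 * cos \<theta>)" "0 \<le> q"
    and \<phi>: "\<theta> < \<phi>" "\<phi> \<le> pi" and \<psi>: "q < \<psi>" "\<psi> \<le> pi" and l: "0 < l"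
  shows "l * exp (- W) * (1 + W) \<le> real (max_code_size d \<theta>) *
    (1 + l * exp (- W) * exp (2 * (l * cap_area d \<psi>)) * cap_area d \<phi>)"
proof -
  define c where "c = cos \<theta>"
  have c: "0 \<le> c" "c < 1"
    using \<theta> cos_ge_zero[of \<theta>] cos_monotone_0_pi[of 0 \<theta>] by (auto simp: c_def)
  define \<eta> where "\<eta> = min (cos \<theta> - cos \<phi>) (cos q - cos \<psi>)"
  have "0 < \<eta>" using cos_monotone_0_pi[of \<theta> \<phi>] cos_monotone_0_pi[of q \<psi>] \<theta> q(2) \<phi> \<psi>
    by (simp add: \<eta>_def)
  then obtain V w where V: "finite V" "V \<subseteq> unit_sphere d"
    and w: "\<And>v. 0 \<le> w v" "sum w V = 1"
    and cap: "\<And>m t \<phi>. m \<in> unit_sphere d \<Longrightarrow> cos \<phi> \<le> t - \<eta> \<Longrightarrow>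
       sum w {v \<in> V. t \<le> ip d m v} \<le> cap_area d \<phi>"
    by (rule discrete_sphere[OF d]) (rule that; assumption)
  define R where "R x y = (c < ip d x y)" for x y
  have Rsym: "R x y \<Longrightarrow> R y x" for x y by (simp add: R_def ip_commute)
  have Rrefl: "R x x" if "x \<in> V" for x
  proof -
    have "ip d x x = 1" using that V(2) by (intro ip_unit) auto
    then show ?thesis using c by (simp add: R_def)
  qed
  have D: "sum w {u \<in> V. R x u} \<le> cap_area d \<phi>" if "x \<in> V" for x
  proof -
    have "sum w {u \<in> V. R x u} \<le> sum w {u \<in> V. c \<le> ip d x u}"
      using V w by (intro sum_mono2) (auto simp: R_def)
    also have "\<dots> \<le> cap_area d \<phi>"
      using that V by (intro cap) (auto simp: c_def \<eta>_def)
    finally show ?thesis .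
  qed
  have Q: "sum w {v \<in> V. R x v \<and> R u v \<and> ip d x u \<le> ip d x v} \<le> cap_area d \<psi>"
    if xu: "x \<in> V" "u \<in> V" "R x u" for x u
  proof -
    have "x \<in> unit_sphere d" "u \<in> unit_sphere d" "c \<le> ip d x u" using xu V by (auto simp: R_def)
    then obtain m where m: "m \<in> unit_sphere d"
      "\<And>v. c \<le> ip d u v \<Longrightarrow> ip d x u \<le> ip d x v \<Longrightarrow> 2 * c / sqrt (2 + 2 * c) \<le> ip d m v"
      by (rule cap_intersection[OF _ _ c(1)]) (rule that; assumption)
    have "sum w {v \<in> V. R x v \<and> R u v \<and> ip d x u \<le> ip d x v} \<le> sum w {v \<in> V. cos q \<le> ip d m v}"
      using V w m(2) by (intro sum_mono2) (auto simp: R_def q(1) c_def)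
    also have "\<dots> \<le> cap_area d \<psi>" using m(1) by (intro cap) (auto simp: \<eta>_def)
    finally show ?thesis .
  qed
  obtain I where I: "I \<in> stable_sets R V" "l * exp (- W) * (1 + W) \<le>
      real (card I) * (1 + l * exp (- W) * exp (2 * (l * cap_area d \<psi>)) * cap_area d \<phi>)"
    by (rule large_stable_set[OF V(1) Rsym Rrefl w D Q l, where W = W]) (assumption | rule that)+
  have "spherical_code d \<theta> I"
    using I(1) V finite_subset[OF _ V(1)]
    by (auto simp: spherical_code_def stable_sets_def R_def c_def not_less)
  then have "card I \<le> max_code_size d \<theta>"
    using \<theta> by (intro card_le_max_code_size) auto
  moreover have "0 \<le> cap_area d \<phi>" by (simp add: cap_area_def sphere_area_def)
  ultimately show ?thesis using l
    by (intro order_trans[OF I(2)] mult_right_mono) auto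
qed

section \<open>Asymptotics of the size of spherical codes\<close>

lemma q_angle_properties:
  assumes \<theta>: "0 < \<theta>" "\<theta> < pi / 2"
  shows "sin (q_angle \<theta>) = sqrt ((1 - cos \<theta>)\<^sup>2 * (1 + 2 * cos \<theta>)) / sin \<theta>"
    and "cos (q_angle \<theta>) = 2 * cos \<theta> / sqrt (2 + 2 * cos \<theta>)"
    and "0 < q_angle \<theta>" "q_angle \<theta> < pi / 2" "sin (q_angle \<theta>) < sin \<theta>"
proof -
  define c where "c = cos \<theta>"
  have c: "0 < c" "c < 1"
    using \<theta> cos_gt_zero[of \<theta>] cos_monotone_0_pi[of 0 \<theta>] by (auto simp: c_def)
  have s: "0 < sin \<theta>" using \<theta> by (intro sin_gt_zero) auto
  have s2: "(sin \<theta>)\<^sup>2 = (1 - c) * (1 + c)"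
    using sin_cos_squared_add[of \<theta>] by (simp add: c_def power2_eq_square algebra_simps)
  define x where "x = sqrt ((1 - c)\<^sup>2 * (1 + 2 * c)) / sin \<theta>"
  have x0: "0 < x" using c s by (simp add: x_def)
  have "x\<^sup>2 = (1 - c)\<^sup>2 * (1 + 2 * c) / (sin \<theta>)\<^sup>2"
    using c by (simp add: x_def power_divide)
  also have "\<dots> = (1 - c) * (1 + 2 * c) / (1 + c)"
    unfolding s2 using c by (simp add: power2_eq_square)
  finally have x2: "x\<^sup>2 = (1 - c) * (1 + 2 * c) / (1 + c)" .
  have xc: "1 - x\<^sup>2 = (2 * c)\<^sup>2 / (2 + 2 * c)"
    using c unfolding x2 by (simp add: field_simps power2_eq_square)
  have "0 < 1 - x\<^sup>2" unfolding xc using c by simp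
  then have x1: "x < 1" using x0 by (simp add: abs_square_less_1)
  have q: "q_angle \<theta> = arcsin x"
    by (simp add: q_angle_def x_def c_def power2_commute)
  show sq: "sin (q_angle \<theta>) = sqrt ((1 - cos \<theta>)\<^sup>2 * (1 + 2 * cos \<theta>)) / sin \<theta>"
    using x0 x1 by (simp add: q x_def[unfolded c_def] c_def)
  show "cos (q_angle \<theta>) = 2 * cos \<theta> / sqrt (2 + 2 * cos \<theta>)"
    using x0 x1 c by (simp add: q cos_arcsin xc real_sqrt_divide real_sqrt_mult c_def)
  show "0 < q_angle \<theta>" using arcsin_less_arcsin[of 0 x] x0 x1 by (simp add: q)
  show "q_angle \<theta> < pi / 2" using arcsin_lt_bounded[of x] x0 x1 by (simp add: q)
  have "(1 - c) * (1 + 2 * c) < (1 - c) * (1 + c)\<^sup>2"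
    using c by (intro mult_strict_left_mono) (auto simp: power2_eq_square algebra_simps)
  then have "x\<^sup>2 < (sin \<theta>)\<^sup>2"
    using c unfolding x2 s2 by (simp add: pos_divide_less_eq power2_eq_square mult.assoc)
  then have "x < sin \<theta>" using s by (simp add: power2_less_imp_less)
  then show "sin (q_angle \<theta>) < sin \<theta>" using x0 x1 by (simp add: q)
qed

lemma isCont_cap_area:
  assumes d: "2 \<le> d" and \<theta>: "0 < \<theta>" "\<theta> < pi / 2"
  shows "isCont (cap_area d) \<theta>"
proof -
  define K where "K = 1 / sqrt pi * (Gamma (real d / 2) / Gamma ((real d - 1) / 2))"
  let ?g = "\<lambda>\<theta>. K * integral {0..\<theta>} (\<lambda>x. sin x ^ (d - 2))"
  have "continuous_on {0..pi / 2} ?g"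
    by (intro continuous_intros indefinite_integral_continuous_1 integrable_continuous_real)
  then have "isCont ?g \<theta>"
    using \<theta> by (intro continuous_on_interior[of "{0..pi / 2}"]) auto
  moreover have "\<forall>\<^sub>F \<phi> in nhds \<theta>. cap_area d \<phi> = ?g \<phi>"
    using eventually_nhds_in_open[of "{0<..<pi / 2}" \<theta>] \<theta>
    by (auto elim!: eventually_mono simp: cap_area_eq[OF d] K_def)
  ultimately show ?thesis by (subst isCont_cong)
qed

text \<open>
  Letting \<open>\<phi>\<close> and \<open>\<psi>\<close> decrease to \<open>\<theta>\<close> and \<open>q_angle \<theta>\<close> removes the slack, since the cap area is continuous.
\<close>

lemma code_size_bound:
  assumes d: "2 \<le> d" and \<theta>: "0 < \<theta>" "\<theta> < pi / 2" and l: "0 < l"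
  shows "l * exp (- W) * (1 + W) \<le> real (max_code_size d \<theta>) *
    (1 + l * exp (- W) * exp (2 * (l * cap_area d (q_angle \<theta>))) * cap_area d \<theta>)"
proof (rule tendsto_lowerbound)
  let ?B = "\<lambda>Q D. real (max_code_size d \<theta>) * (1 + l * exp (- W) * exp (2 * (l * Q)) * D)"
  note q = q_angle_properties[OF \<theta>]
  have lim: "((\<lambda>e. cap_area d (\<phi> + e)) \<longlongrightarrow> cap_area d \<phi>) (at_right 0)" if "0 < \<phi>" "\<phi> < pi / 2" for \<phi>
  proof -
    have "((\<lambda>e. \<phi> + e) \<longlongrightarrow> \<phi> + 0) (at_right 0)" by (intro tendsto_intros)
    then have "((\<lambda>e. \<phi> + e) \<longlongrightarrow> \<phi>) (at_right 0)" by simp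
    then show ?thesis by (rule isCont_tendsto_compose[OF isCont_cap_area[OF d that]])
  qed
  show "((\<lambda>e. ?B (cap_area d (q_angle \<theta> + e)) (cap_area d (\<theta> + e)))
      \<longlongrightarrow> ?B (cap_area d (q_angle \<theta>)) (cap_area d \<theta>)) (at_right 0)"
    by (intro tendsto_intros lim \<theta> q)
  have "\<forall>\<^sub>F e in at_right 0. e \<in> {0<..<pi / 2 :: real}"
    by (intro eventually_at_right_real) simp
  then show "\<forall>\<^sub>F e in at_right 0. l * exp (- W) * (1 + W) \<le>
      ?B (cap_area d (q_angle \<theta> + e)) (cap_area d (\<theta> + e))"
  proof eventually_elim
    case (elim e)
    then show ?case using \<theta> q by (intro code_size_bound_approx d l) auto
  qed
qed simp

lemma integral_sin_power_cos:
  "((\<lambda>x::real. sin x ^ n * cos x) has_integral sin b ^ (n + 1) / real (n + 1)) {0..b}" if "0 \<le> b"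
proof -
  have "((\<lambda>x::real. sin x ^ n * cos x) has_integral
      sin b ^ (n + 1) / real (n + 1) - sin 0 ^ (n + 1) / real (n + 1)) {0..b}"
  proof (rule fundamental_theorem_of_calculus[OF that])
    fix x :: real
    have "((\<lambda>x. sin x ^ (n + 1) / real (n + 1)) has_real_derivative
        real (n + 1) * (cos x * sin x ^ (n + 1 - Suc 0)) / real (n + 1)) (at x within {0..b})"
      by (rule DERIV_cdivide[OF DERIV_power[OF DERIV_subset[OF DERIV_sin subset_UNIV]]])
    also have "real (n + 1) * (cos x * sin x ^ (n + 1 - Suc 0)) / real (n + 1) = sin x ^ n * cos x"
      by (simp del: of_nat_add of_nat_Suc)
    finally show "((\<lambda>x. sin x ^ (n + 1) / real (n + 1)) has_vector_derivative sin x ^ n * cos x)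
        (at x within {0..b})"
      by (simp add: has_real_derivative_iff_has_vector_derivative)
  qed
  then show ?thesis by simp
qed

text \<open>
  Compared with \<open>sin x ^ n * cos x\<close>, whose integral is elementary, the integrand gains a factor between
  \<open>1\<close> and \<open>1 / cos b\<close>; so the integral is known up to a factor that does not depend on \<open>n\<close>.
\<close>

lemma integral_sin_power_bounds:
  assumes "0 < b" "b < pi / 2"
  shows "sin b ^ (n + 1) / (n + 1) \<le> integral {0..b} (\<lambda>x. sin x ^ n)"
    and "integral {0..b} (\<lambda>x. sin x ^ n) \<le> sin b ^ (n + 1) / (n + 1) / cos b"
proof -
  have I: "((\<lambda>x. sin x ^ n) has_integral integral {0..b} (\<lambda>x. sin x ^ n)) {0..b}"
    by (intro integrable_integral integrable_continuous_real continuous_intros)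
  have s: "0 \<le> sin x ^ n" if "x \<in> {0..b}" for x
    using that assms by (intro zero_le_power sin_ge_zero) auto
  have cb: "0 < cos b" using assms by (intro cos_gt_zero) auto
  note J = integral_sin_power_cos[of b n]
  show "sin b ^ (n + 1) / (n + 1) \<le> integral {0..b} (\<lambda>x. sin x ^ n)"
  proof (rule has_integral_le[OF J I])
    show "sin x ^ n * cos x \<le> sin x ^ n" if "x \<in> {0..b}" for x
      using s[OF that] by (intro mult_left_le) auto
  qed (use assms in simp)
  show "integral {0..b} (\<lambda>x. sin x ^ n) \<le> sin b ^ (n + 1) / (n + 1) / cos b"
  proof (rule has_integral_le[OF I])
    show "((\<lambda>x. sin x ^ n * cos x / cos b) has_integral sin b ^ (n + 1) / (n + 1) / cos b) {0..b}"
      using has_integral_divide[OF J, of "cos b"] assms by simp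
    fix x assume x: "x \<in> {0..b}"
    then have "cos b \<le> cos x" using assms by (intro cos_monotone_0_pi_le) auto
    then have "sin x ^ n * cos b \<le> sin x ^ n * cos x" by (intro mult_left_mono s x)
    then show "sin x ^ n \<le> sin x ^ n * cos x / cos b" using cb by (simp add: pos_le_divide_eq)
  qed
qed

lemma cap_area_ratio:
  assumes d: "2 \<le> d" and \<theta>: "0 < \<theta>" "\<theta> < pi / 2" and q: "0 < q" "q < pi / 2"
  shows "0 < cap_area d \<theta>"
    and "(sin \<theta> / sin q) ^ (d - 1) * cos q \<le> cap_area d \<theta> / cap_area d q"
proof -
  define K where "K = 1 / sqrt pi * (Gamma (real d / 2) / Gamma ((real d - 1) / 2))"
  have K: "0 < K" using d by (simp add: K_def)
  obtain n where n: "d = n + 2" using d by (metis le_add_diff_inverse2)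
  let ?I = "\<lambda>b. integral {0..b} (\<lambda>x::real. sin x ^ n)"
  have A: "cap_area d b = K * ?I b" if "0 < b" "b < pi / 2" for b
    using cap_area_eq[OF d that] by (simp add: K_def n)
  have pos: "0 < ?I b" if "0 < b" "b < pi / 2" for b
  proof -
    have "0 < sin b" using that by (intro sin_gt_zero) auto
    then have "0 < sin b ^ (n + 1) / (n + 1)" by simp
    then show ?thesis using integral_sin_power_bounds(1)[OF that, of n] by linarith
  qed
  show "0 < cap_area d \<theta>" using A K pos \<theta> by simp
  have sc: "0 < sin q" "0 < cos q" "0 < sin \<theta>"
    using q \<theta> by (auto intro!: sin_gt_zero cos_gt_zero)
  define m where "m = real (n + 1)"
  have m: "0 < m" by (simp add: m_def)
  have "(sin \<theta> / sin q) ^ (n + 1) * cos q =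
      (sin \<theta> ^ (n + 1) / m) / (sin q ^ (n + 1) / m / cos q)"
    using m sc by (simp add: power_divide field_simps)
  also have "\<dots> \<le> ?I \<theta> / ?I q"
    using integral_sin_power_bounds[OF \<theta>, of n] integral_sin_power_bounds[OF q, of n]
      pos[OF q] pos[OF \<theta>] sc m unfolding m_def by (intro frac_le) auto
  also have "\<dots> = cap_area d \<theta> / cap_area d q" using A \<theta> q K by simp
  finally show "(sin \<theta> / sin q) ^ (d - 1) * cos q \<le> cap_area d \<theta> / cap_area d q"
    by (simp add: n)
qed

text \<open>
  With \<open>l = 1 / (d * Q)\<close>, where \<open>Q\<close> is the area of the small cap, the factor \<open>exp (2 * (l * Q))\<close> is
  \<open>exp (2 / d)\<close> and tends to \<open>1\<close>. The choice of \<open>W\<close> makes \<open>l * exp (- W)\<close> equal to \<open>d\<close> divided by the area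
  of the large cap, so that the summand \<open>1\<close> in \<open>code_size_bound\<close> is negligible beside \<open>d * exp (2 / d)\<close>.
  Both choices together lower \<open>W\<close> by only \<open>2 * ln d\<close> against the linear growth of the logarithm of the ratio
  of the areas.
\<close>

lemma code_size_lower_bound:
  assumes d: "2 \<le> d" and \<theta>: "0 < \<theta>" "\<theta> < pi / 2"
  shows "(1 + (real (d - 1) * c_const \<theta> + ln (cos (q_angle \<theta>)) - 2 * ln (real d))) /
      (1 + real d * exp (2 / real d)) * (real d / cap_area d \<theta>) \<le> real (max_code_size d \<theta>)"
proof -
  note q = q_angle_properties[OF \<theta>]
  let ?s = "cap_area d \<theta>" and ?Q = "cap_area d (q_angle \<theta>)"
  have s: "0 < ?s" and Q: "0 < ?Q" using cap_area_ratio(1)[OF d] \<theta> q by auto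
  have sq: "0 < sin (q_angle \<theta>)" "0 < cos (q_angle \<theta>)" "0 < sin \<theta>"
    using q(3,4) \<theta> by (auto intro!: sin_gt_zero cos_gt_zero)
  define W where "W = ln (?s / ?Q) - 2 * ln (real d)"
  define l where "l = 1 / (real d * ?Q)"
  have d0: "0 < real d" using d by simp
  have "- W = ln ((real d)\<^sup>2 * ?Q / ?s)"
    using s Q d0 by (simp add: W_def ln_div ln_mult ln_realpow)
  then have "exp (- W) = (real d)\<^sup>2 * ?Q / ?s" using s Q d0 by simp
  then have lW: "l * exp (- W) = real d / ?s"
    using Q d0 s by (simp add: l_def power2_eq_square)
  have "l * exp (- W) * (1 + W) \<le> real (max_code_size d \<theta>) *
      (1 + l * exp (- W) * exp (2 * (l * ?Q)) * ?s)"
    using d0 Q by (intro code_size_bound d \<theta>) (simp add: l_def)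
  also have "1 + l * exp (- W) * exp (2 * (l * ?Q)) * ?s = 1 + real d * exp (2 / real d)"
    unfolding lW using s Q by (simp add: l_def)
  finally have main: "real d / ?s * (1 + W) \<le>
      real (max_code_size d \<theta>) * (1 + real d * exp (2 / real d))"
    unfolding lW .
  have "real (d - 1) * c_const \<theta> + ln (cos (q_angle \<theta>)) =
      ln ((sin \<theta> / sin (q_angle \<theta>)) ^ (d - 1) * cos (q_angle \<theta>))"
    using sq by (simp add: ln_mult ln_realpow c_const_def)
  also have "\<dots> \<le> ln (?s / ?Q)"
    using cap_area_ratio(2)[OF d \<theta> q(3,4)] sq s Q by (subst ln_le_cancel_iff) auto
  finally have W: "real (d - 1) * c_const \<theta> + ln (cos (q_angle \<theta>)) - 2 * ln (real d) \<le> W"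
    by (simp add: W_def)
  have E: "0 < 1 + real d * exp (2 / real d)" by (simp add: add_pos_nonneg)
  have "real d / ?s * (1 + (real (d - 1) * c_const \<theta> + ln (cos (q_angle \<theta>)) - 2 * ln (real d)))
      \<le> real d / ?s * (1 + W)"
    using W s by (intro mult_left_mono) auto
  also note main
  finally have "real d / ?s * (1 + (real (d - 1) * c_const \<theta> + ln (cos (q_angle \<theta>)) - 2 * ln (real d)))
      / (1 + real d * exp (2 / real d)) \<le> real (max_code_size d \<theta>)"
    by (simp only: pos_divide_le_eq[OF E])
  moreover have "x / E * y = y * x / E" for x y E :: real by simp
  ultimately show ?thesis by (simp only:)
qed

theorem theorem2:
  fixes \<theta> :: real
  assumes "0 < \<theta>" and "\<theta> < pi / 2"
  shows "c_const \<theta> = ln ((sin \<theta>)\<^sup>2 / sqrt ((1 - cos \<theta>)\<^sup>2 * (1 + 2 * cos \<theta>))) \<and>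
    (\<exists>\<epsilon> :: nat \<Rightarrow> real. \<epsilon> \<longlonglongrightarrow> 0 \<and>
      (\<forall>\<^sub>F d in sequentially.
        real (max_code_size d \<theta>) \<ge> (1 + \<epsilon> d) * (c_const \<theta> * real d / cap_area d \<theta>)))"
proof
  note q = q_angle_properties[OF assms]
  show "c_const \<theta> = ln ((sin \<theta>)\<^sup>2 / sqrt ((1 - cos \<theta>)\<^sup>2 * (1 + 2 * cos \<theta>)))"
    unfolding c_const_def q(1) by (simp add: power2_eq_square)
  have "0 < sin (q_angle \<theta>)" using q(3,4) by (intro sin_gt_zero) auto
  then have c: "0 < c_const \<theta>" using q(5) by (simp add: c_const_def)
  define L where "L = ln (cos (q_angle \<theta>))"
  define c where "c = c_const \<theta>"
  define \<epsilon> where "\<epsilon> d = (1 + (real (d - 1) * c + L - 2 * ln (real d))) /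
      (1 + real d * exp (2 / real d)) / c - 1" for d :: nat
  have "(\<lambda>d::nat. (1 + ((real d - 1) * c + L - 2 * ln (real d))) /
      (1 + real d * exp (2 / real d)) / c - 1) \<longlonglongrightarrow> 0"
    using c unfolding c_def[symmetric] by real_asymp
  moreover have "\<forall>\<^sub>F d in sequentially. (1 + ((real d - 1) * c + L - 2 * ln (real d))) /
      (1 + real d * exp (2 / real d)) / c - 1 = \<epsilon> d"
    using eventually_ge_at_top[of 1] by eventually_elim (simp add: \<epsilon>_def of_nat_diff)
  ultimately have "\<epsilon> \<longlonglongrightarrow> 0" by (rule Lim_transform_eventually)
  moreover have "\<forall>\<^sub>F d in sequentially.
      real (max_code_size d \<theta>) \<ge> (1 + \<epsilon> d) * (c_const \<theta> * real d / cap_area d \<theta>)"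
    using eventually_ge_at_top[of 2]
  proof eventually_elim
    case (elim d)
    have "(1 + \<epsilon> d) * (c_const \<theta> * real d / cap_area d \<theta>) =
        (1 + (real (d - 1) * c + L - 2 * ln (real d))) /
        (1 + real d * exp (2 / real d)) * (real d / cap_area d \<theta>)"
      using c by (simp add: \<epsilon>_def c_def)
    then show ?case using code_size_lower_bound[OF elim assms] by (simp add: c_def L_def)
  qed
  ultimately show "\<exists>\<epsilon> :: nat \<Rightarrow> real. \<epsilon> \<longlonglongrightarrow> 0 \<and> (\<forall>\<^sub>F d in sequentially.
        real (max_code_size d \<theta>) \<ge> (1 + \<epsilon> d) * (c_const \<theta> * real d / cap_area d \<theta>))"
    by blast
qed

end
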